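(* Let $(\mathcal M,g)$ be a smooth globally hyperbolic spacetime with causal relation $\leq$. Then the directed completion of $(\mathcal M,\leq)$ is $(\mathcal C^+(\mathcal M),\subseteq)$, where $\mathcal C^+(\mathcal M)$ is the set of all indecomposable past sets of $\mathcal M$.
   Context: For a spacetime $\mathcal M$ with chronological relation $\ll$ and causal relation $\leq$, put $I^-(x)=\{y:y\ll x\}$ and $I^-(A)=\bigcup_{x\in A}I^-(x)$. A set $U\subseteq\mathcal M$ is past if $I^-(U)=U$. A nonempty past set $P$ is an indecomposable past set if whenever $P=U_1\cup U_2$ with past sets $U_1,U_2\subseteq P$, then $P=U_1$ or $P=U_2$. $(\mathcal C^+(\mathcal M),\subseteq)$, the set of indecomposable past sets ordered by inclusion, is called the future causal completion. In a poset, $D$ is directed if every finite $F\subseteq D$ (including $F=\emptyset$) has an upper bound in $D$; a poset is directed complete if every directed subset has a supremum. A map $T:(X_1,\leq_1)\to(X_2,\leq_2)$ between posets has the monotone convergence property (Mcp) if for every directed $D\subseteq X_1$ admitting a supremum, $T(D)$ admits a supremum and $\sup T(D)=T(\sup D)$. A directed completion of a poset $(X,\leq)$ is a directed complete poset $(\overline X,\overline\leq)$ with a map $\iota:X\to\overline X$ having the Mcp such that for every directed complete poset $(Z,\leq_Z)$ and every map $T:X\to Z$ with the Mcp there is a unique map $\overline T:\overline X\to Z$ with the Mcp such that $\overline T\circ\iota=T$. Here the map is $\iota:\mathcal M\to\mathcal C^+(\mathcal M)$, $\iota(x)=I^-(x)$. *)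

theory Defs
  imports "HOL-Analysis.Analysis" "HOL-Algebra.Order"
begin

section \<open>Smooth manifolds\<close>

text \<open>
  \<open>Ck_on k S f\<close> is only meant for open \<open>S\<close>. Differentiability up to order \<open>k\<close> is expressed
  through iterated directional derivatives, so that the codomain stays the same in the recursion.
\<close>

primrec Ck_on ::
  "nat \<Rightarrow> 'a::real_normed_vector set \<Rightarrow> ('a \<Rightarrow> 'b::real_normed_vector) \<Rightarrow> bool" where
  "Ck_on 0 S f \<longleftrightarrow> continuous_on S f"
| "Ck_on (Suc k) S f \<longleftrightarrow>
     (\<forall>x\<in>S. f differentiable (at x)) \<and> (\<forall>v. Ck_on k S (\<lambda>x. frechet_derivative f (at x) v))"

definition smooth_on ::
  "'a::real_normed_vector set \<Rightarrow> ('a \<Rightarrow> 'b::real_normed_vector) \<Rightarrow> bool" where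
  "smooth_on S f \<longleftrightarrow> (\<forall>k. Ck_on k S f)"

text \<open>
  The underlying topological space of a manifold is the type \<open>'m\<close>, assumed Hausdorff and second
  countable. A chart is a pair of its domain and its coordinate map; the values of the coordinate
  map outside the domain are irrelevant.
\<close>

type_synonym ('m, 'e) chart = "'m set \<times> ('m \<Rightarrow> 'e)"

abbreviation chart_dom :: "('m, 'e) chart \<Rightarrow> 'm set" where
  "chart_dom c \<equiv> fst c"

abbreviation chart_inv :: "('m, 'e) chart \<Rightarrow> 'e \<Rightarrow> 'm" where
  "chart_inv c \<equiv> inv_into (chart_dom c) (snd c)"

definition is_chart :: "('m::topological_space, 'e::euclidean_space) chart \<Rightarrow> bool" where
  "is_chart c \<longleftrightarrow> open (chart_dom c) \<and> open (snd c ` chart_dom c) \<and>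
     homeomorphism (chart_dom c) (snd c ` chart_dom c) (snd c) (chart_inv c)"

definition coord_change :: "('m, 'e) chart \<Rightarrow> ('m, 'e) chart \<Rightarrow> 'e \<Rightarrow> 'e" where
  "coord_change c d = snd d \<circ> chart_inv c"

definition jacobian ::
  "('m, 'e::euclidean_space) chart \<Rightarrow> ('m, 'e) chart \<Rightarrow> 'm \<Rightarrow> 'e \<Rightarrow> 'e" where
  "jacobian c d p = frechet_derivative (coord_change c d) (at (snd c p))"

definition smooth_atlas :: "('m::topological_space, 'e::euclidean_space) chart set \<Rightarrow> bool" where
  "smooth_atlas A \<longleftrightarrow>
     (\<forall>c\<in>A. is_chart c) \<and> (\<Union>c\<in>A. chart_dom c) = UNIV \<and>
     (\<forall>c\<in>A. \<forall>d\<in>A. smooth_on (snd c ` (chart_dom c \<inter> chart_dom d)) (coord_change c d))"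

section \<open>Spacetimes\<close>

text \<open>
  Tensor fields are given by their coordinate representatives in each chart of the atlas, subject
  to the usual transformation law: \<open>metric M c p\<close> is the bilinear form \<open>g\<^sub>p\<close> in the coordinates
  \<open>c\<close>, and \<open>time_field M c p\<close> the coordinate vector of the time-orienting vector field at \<open>p\<close>.
\<close>

record ('m, 'e) spacetime =
  atlas :: "('m, 'e) chart set"
  metric :: "('m, 'e) chart \<Rightarrow> 'm \<Rightarrow> 'e \<Rightarrow> 'e \<Rightarrow> real"
  time_field :: "('m, 'e) chart \<Rightarrow> 'm \<Rightarrow> 'e"

text \<open>Signature \<open>(-,+,\<dots>,+)\<close>, witnessed by an orthonormal basis with timelike member \<open>e\<close>.\<close>

definition lorentzian_form :: "('e::euclidean_space \<Rightarrow> 'e \<Rightarrow> real) \<Rightarrow> bool" where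
  "lorentzian_form b \<longleftrightarrow> bilinear b \<and>
     (\<exists>B e. independent B \<and> span B = UNIV \<and> e \<in> B \<and>
        (\<forall>u\<in>B. \<forall>v\<in>B. b u v = (if u \<noteq> v then 0 else if u = e then - 1 else 1)))"

definition lorentzian_metric ::
  "('m::topological_space, 'e::euclidean_space) spacetime \<Rightarrow> bool" where
  "lorentzian_metric M \<longleftrightarrow>
     (\<forall>c\<in>atlas M. \<forall>p\<in>chart_dom c. lorentzian_form (metric M c p)) \<and>
     (\<forall>c\<in>atlas M. \<forall>v w.
        smooth_on (snd c ` chart_dom c) (\<lambda>x. metric M c (chart_inv c x) v w)) \<and>
     (\<forall>c\<in>atlas M. \<forall>d\<in>atlas M. \<forall>p\<in>chart_dom c \<inter> chart_dom d. \<forall>v w.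
        metric M c p v w = metric M d p (jacobian c d p v) (jacobian c d p w))"

definition time_orientation ::
  "('m::topological_space, 'e::euclidean_space) spacetime \<Rightarrow> bool" where
  "time_orientation M \<longleftrightarrow>
     (\<forall>c\<in>atlas M. continuous_on (chart_dom c) (time_field M c)) \<and>
     (\<forall>c\<in>atlas M. \<forall>d\<in>atlas M. \<forall>p\<in>chart_dom c \<inter> chart_dom d.
        time_field M d p = jacobian c d p (time_field M c p)) \<and>
     (\<forall>c\<in>atlas M. \<forall>p\<in>chart_dom c. metric M c p (time_field M c p) (time_field M c p) < 0)"

definition smooth_spacetime ::
  "('m::{t2_space,second_countable_topology}, 'e::euclidean_space) spacetime \<Rightarrow> bool" where
  "smooth_spacetime M \<longleftrightarrow> connected (UNIV :: 'm set) \<and>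
     smooth_atlas (atlas M) \<and> lorentzian_metric M \<and> time_orientation M"

section \<open>Causality\<close>

definition velocity :: "('m, 'e::euclidean_space) chart \<Rightarrow> (real \<Rightarrow> 'm) \<Rightarrow> real \<Rightarrow> real \<Rightarrow> real \<Rightarrow> 'e"
  where "velocity c \<gamma> a b t = vector_derivative (snd c \<circ> \<gamma>) (at t within {a..b})"

text \<open>A \<open>C\<^sup>1\<close> curve on the closed interval \<open>{a..b}\<close>; derivatives at the endpoints are one-sided.\<close>

definition C1_segment ::
  "('m::topological_space, 'e::euclidean_space) spacetime \<Rightarrow> (real \<Rightarrow> 'm) \<Rightarrow> real \<Rightarrow> real \<Rightarrow> bool"
  where
  "C1_segment M \<gamma> a b \<longleftrightarrow> a < b \<and> continuous_on {a..b} \<gamma> \<and>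
     (\<forall>c\<in>atlas M.
        (\<forall>t\<in>{a..b} \<inter> \<gamma> -` chart_dom c. (snd c \<circ> \<gamma>) differentiable (at t within {a..b})) \<and>
        continuous_on ({a..b} \<inter> \<gamma> -` chart_dom c) (velocity c \<gamma> a b))"

text \<open>Since the time field is timelike, a causal vector \<open>v\<close> at \<open>p\<close> is future-directed iff its
  product with the time field is negative.\<close>

definition future_timelike ::
  "('m, 'e::euclidean_space) spacetime \<Rightarrow> ('m, 'e) chart \<Rightarrow> 'm \<Rightarrow> 'e \<Rightarrow> bool" where
  "future_timelike M c p v \<longleftrightarrow> metric M c p v v < 0 \<and> metric M c p v (time_field M c p) < 0"

definition future_causal ::
  "('m, 'e::euclidean_space) spacetime \<Rightarrow> ('m, 'e) chart \<Rightarrow> 'm \<Rightarrow> 'e \<Rightarrow> bool" where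
  "future_causal M c p v \<longleftrightarrow>
     v \<noteq> 0 \<and> metric M c p v v \<le> 0 \<and> metric M c p v (time_field M c p) < 0"

definition timelike_segment ::
  "('m::topological_space, 'e::euclidean_space) spacetime \<Rightarrow> (real \<Rightarrow> 'm) \<Rightarrow> real \<Rightarrow> real \<Rightarrow> bool"
  where
  "timelike_segment M \<gamma> a b \<longleftrightarrow> C1_segment M \<gamma> a b \<and>
     (\<forall>c\<in>atlas M. \<forall>t\<in>{a..b} \<inter> \<gamma> -` chart_dom c.
        future_timelike M c (\<gamma> t) (velocity c \<gamma> a b t))"

definition causal_segment ::
  "('m::topological_space, 'e::euclidean_space) spacetime \<Rightarrow> (real \<Rightarrow> 'm) \<Rightarrow> real \<Rightarrow> real \<Rightarrow> bool"
  where
  "causal_segment M \<gamma> a b \<longleftrightarrow> C1_segment M \<gamma> a b \<and>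
     (\<forall>c\<in>atlas M. \<forall>t\<in>{a..b} \<inter> \<gamma> -` chart_dom c.
        future_causal M c (\<gamma> t) (velocity c \<gamma> a b t))"

definition piecewise ::
  "((real \<Rightarrow> 'm) \<Rightarrow> real \<Rightarrow> real \<Rightarrow> bool) \<Rightarrow> (real \<Rightarrow> 'm) \<Rightarrow> real \<Rightarrow> real \<Rightarrow> bool" where
  "piecewise P \<gamma> a b \<longleftrightarrow>
     (\<exists>(n::nat) s. 0 < n \<and> s 0 = a \<and> s n = b \<and> (\<forall>i<n. s i < s (Suc i) \<and> P \<gamma> (s i) (s (Suc i))))"

definition timelike_curve ::
  "('m::topological_space, 'e::euclidean_space) spacetime \<Rightarrow> (real \<Rightarrow> 'm) \<Rightarrow> real \<Rightarrow> real \<Rightarrow> bool"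
  where "timelike_curve M = piecewise (timelike_segment M)"

definition causal_curve ::
  "('m::topological_space, 'e::euclidean_space) spacetime \<Rightarrow> (real \<Rightarrow> 'm) \<Rightarrow> real \<Rightarrow> real \<Rightarrow> bool"
  where "causal_curve M = piecewise (causal_segment M)"

definition chronological ::
  "('m::topological_space, 'e::euclidean_space) spacetime \<Rightarrow> 'm \<Rightarrow> 'm \<Rightarrow> bool" where
  "chronological M p q \<longleftrightarrow> (\<exists>\<gamma> a b. timelike_curve M \<gamma> a b \<and> \<gamma> a = p \<and> \<gamma> b = q)"

definition causal ::
  "('m::topological_space, 'e::euclidean_space) spacetime \<Rightarrow> 'm \<Rightarrow> 'm \<Rightarrow> bool" where
  "causal M p q \<longleftrightarrow> p = q \<or> (\<exists>\<gamma> a b. causal_curve M \<gamma> a b \<and> \<gamma> a = p \<and> \<gamma> b = q)"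

definition strongly_causal ::
  "('m::topological_space, 'e::euclidean_space) spacetime \<Rightarrow> bool" where
  "strongly_causal M \<longleftrightarrow>
     (\<forall>p U. open U \<and> p \<in> U \<longrightarrow>
        (\<exists>V. open V \<and> p \<in> V \<and> V \<subseteq> U \<and>
           (\<forall>\<gamma> a b. causal_curve M \<gamma> a b \<and> \<gamma> a \<in> V \<and> \<gamma> b \<in> V \<longrightarrow> \<gamma> ` {a..b} \<subseteq> U)))"

definition globally_hyperbolic ::
  "('m::topological_space, 'e::euclidean_space) spacetime \<Rightarrow> bool" where
  "globally_hyperbolic M \<longleftrightarrow>
     strongly_causal M \<and> (\<forall>p q. compact {r. causal M p r \<and> causal M r q})"

section \<open>The future causal completion\<close>

definition chron_past ::
  "('m::topological_space, 'e::euclidean_space) spacetime \<Rightarrow> 'm \<Rightarrow> 'm set" where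
  "chron_past M x = {y. chronological M y x}"

definition past_set ::
  "('m::topological_space, 'e::euclidean_space) spacetime \<Rightarrow> 'm set \<Rightarrow> bool" where
  "past_set M U \<longleftrightarrow> (\<Union>x\<in>U. chron_past M x) = U"

definition indecomposable_past_set ::
  "('m::topological_space, 'e::euclidean_space) spacetime \<Rightarrow> 'm set \<Rightarrow> bool" where
  "indecomposable_past_set M P \<longleftrightarrow> P \<noteq> {} \<and> past_set M P \<and>
     (\<forall>U1 U2. past_set M U1 \<and> past_set M U2 \<and> U1 \<subseteq> P \<and> U2 \<subseteq> P \<and> P = U1 \<union> U2 \<longrightarrow>
        P = U1 \<or> P = U2)"

definition causal_poset ::
  "('m::topological_space, 'e::euclidean_space) spacetime \<Rightarrow> 'm gorder" where
  "causal_poset M = \<lparr>carrier = UNIV, eq = (=), le = causal M\<rparr>"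

definition future_causal_completion ::
  "('m::topological_space, 'e::euclidean_space) spacetime \<Rightarrow> 'm set gorder" where
  "future_causal_completion M =
     \<lparr>carrier = {P. indecomposable_past_set M P}, eq = (=), le = (\<subseteq>)\<rparr>"

section \<open>Directed completions\<close>

definition directed_subset :: "'a gorder \<Rightarrow> 'a set \<Rightarrow> bool" where
  "directed_subset X D \<longleftrightarrow> D \<subseteq> carrier X \<and>
     (\<forall>F. finite F \<and> F \<subseteq> D \<longrightarrow> (\<exists>u\<in>D. \<forall>x\<in>F. x \<sqsubseteq>\<^bsub>X\<^esub> u))"

definition directed_complete :: "'a gorder \<Rightarrow> bool" where
  "directed_complete X \<longleftrightarrow> partial_order X \<and> (\<forall>D. directed_subset X D \<longrightarrow> (\<exists>s. is_lub X s D))"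

text \<open>Maps \<open>X \<rightarrow> Y\<close> with the monotone convergence property.\<close>

definition Mcp :: "'a gorder \<Rightarrow> 'b gorder \<Rightarrow> ('a \<Rightarrow> 'b) \<Rightarrow> bool" where
  "Mcp X Y T \<longleftrightarrow> T \<in> carrier X \<rightarrow> carrier Y \<and>
     (\<forall>D s. directed_subset X D \<and> is_lub X s D \<longrightarrow> is_lub Y (T s) (T ` D))"

text \<open>
  A quantifier cannot range over types, so the type \<open>'z\<close> of elements of the test posets \<open>Z\<close> is a
  parameter; a theorem with \<open>'z\<close> free states the universal property for all \<open>Z\<close>. Maps into \<open>Z\<close>
  are compared on the carrier only, hence the unique extension is sought among the extensional
  functions.
\<close>

definition directed_completion ::
  "'z itself \<Rightarrow> 'a gorder \<Rightarrow> 'b gorder \<Rightarrow> ('a \<Rightarrow> 'b) \<Rightarrow> bool" where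
  "directed_completion _ X Y \<iota> \<longleftrightarrow>
     partial_order X \<and> directed_complete Y \<and> Mcp X Y \<iota> \<and>
     (\<forall>(Z :: 'z gorder) T. directed_complete Z \<and> Mcp X Z T \<longrightarrow>
        (\<exists>!T'. T' \<in> extensional (carrier Y) \<and> Mcp Y Z T' \<and> (\<forall>x\<in>carrier X. T' (\<iota> x) = T x)))"

end

theory Submission
  imports Defs
begin

text \<open>
  Write \<open>\<ll>\<close> for the chronological and \<open>\<le>\<close> for the causal relation. The statement is order-theoretic
  once the following facts about a globally hyperbolic spacetime are known: \<open>\<le>\<close> is a partial order
  containing \<open>\<ll>\<close>; \<open>y \<ll> x \<le> z\<close> implies \<open>y \<ll> z\<close> (push-up); chronological futures are open; every
  point is a limit of points in its chronological past; causal diamonds are compact. They are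
  collected in the locale \<open>chronological_causal_order\<close> and established in
  \<open>globally_hyperbolic_order\<close>.

  Order theory. A past set is indecomposable iff it is nonempty and any two of its points have a
  common chronological successor in it; so it is directed for \<open>\<le>\<close>, and a directed union of
  indecomposable past sets is one again and is their supremum. If a directed set \<open>D\<close> has a supremum
  \<open>s\<close> in the spacetime, compactness of a diamond \<open>J(d, s)\<close> yields a cluster point of \<open>D\<close> that is an upper
  bound below \<open>s\<close>, hence equals \<open>s\<close>; as the future of a point \<open>y \<ll> s\<close> is open, it meets \<open>D\<close>. Together
  with push-up this gives \<open>I\<^sup>-(s) = (\<Union>d\<in>D. I\<^sup>-(d))\<close>, which is the Mcp of \<open>I\<^sup>-\<close>. Moreover \<open>x\<close> is the
  supremum of \<open>I\<^sup>-(x)\<close>, because a diamond is closed and \<open>x\<close> is a limit of its past. A map \<open>T\<close> with the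
  Mcp therefore extends by \<open>P \<mapsto> sup T(P)\<close>, and in no other way, since \<open>P\<close> is the directed union of the
  \<open>I\<^sup>-(x)\<close> with \<open>x \<in> P\<close>.

  Geometry. Openness of futures and density of pasts come from straight coordinate lines: being
  future timelike is an open condition on base point and vector together. Push-up is the one fact
  that concerns causal curves. Near a given point, a causal curve \<open>\<gamma>\<close> on \<open>[s, t]\<close> is replaced in
  coordinates by \<open>\<gamma>(\<tau>) - \<epsilon> (t - \<tau>) w\<close> with \<open>w\<close> a constant future timelike vector. Its
  velocity is tilted by \<open>\<epsilon> w\<close>, which lowers \<open>g(\<gamma>', \<gamma>')\<close> by an amount of order \<open>\<epsilon>\<close>, whereas moving the base
  point costs only \<open>O(\<epsilon> (t - s))\<close> because the metric is Lipschitz along \<open>w\<close>. On short intervals the new curve is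
  timelike; it ends at \<open>\<gamma>(t)\<close> and starts as close to \<open>\<gamma>(s)\<close> as desired. A bisection argument passes from
  short to arbitrary intervals.
\<close>

section \<open>Segments and piecewise curves\<close>

text \<open>
  Timelike and causal segments differ only in the pointwise condition \<open>R\<close> on the velocity, so facts on
  restricting, shifting and joining curves are shared between them.
\<close>

definition segment_with ::
  "(('m, 'e) chart \<Rightarrow> 'm \<Rightarrow> 'e \<Rightarrow> bool) \<Rightarrow>
   ('m::topological_space, 'e::euclidean_space) spacetime \<Rightarrow> (real \<Rightarrow> 'm) \<Rightarrow> real \<Rightarrow> real \<Rightarrow> bool"
  where
  "segment_with R M \<gamma> a b \<longleftrightarrow> C1_segment M \<gamma> a b \<and>
     (\<forall>c\<in>atlas M. \<forall>t\<in>{a..b} \<inter> \<gamma> -` chart_dom c. R c (\<gamma> t) (velocity c \<gamma> a b t))"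

lemma timelike_segment_eq: "timelike_segment M = segment_with (future_timelike M) M"
  by (intro ext) (simp add: timelike_segment_def segment_with_def)

lemma causal_segment_eq: "causal_segment M = segment_with (future_causal M) M"
  by (intro ext) (simp add: causal_segment_def segment_with_def)

text \<open>
  \<open>velocity\<close> is a choice operator applied to the one-sided derivative. On a nondegenerate interval the
  derivative is unique, so any candidate \<open>V\<close> for it may be exhibited instead.
\<close>

lemma segment_withI:
  assumes "a < b" "continuous_on {a..b} \<gamma>"
    and V: "\<And>c. c \<in> atlas M \<Longrightarrow> \<exists>V. continuous_on ({a..b} \<inter> \<gamma> -` chart_dom c) V \<and>
      (\<forall>t\<in>{a..b} \<inter> \<gamma> -` chart_dom c.
        ((snd c \<circ> \<gamma>) has_vector_derivative V t) (at t within {a..b}) \<and> R c (\<gamma> t) (V t))"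
  shows "segment_with R M \<gamma> a b"
proof -
  have "(\<forall>t\<in>{a..b} \<inter> \<gamma> -` chart_dom c.
           (snd c \<circ> \<gamma>) differentiable (at t within {a..b}) \<and> R c (\<gamma> t) (velocity c \<gamma> a b t)) \<and>
        continuous_on ({a..b} \<inter> \<gamma> -` chart_dom c) (velocity c \<gamma> a b)"
    if c: "c \<in> atlas M" for c
  proof -
    let ?I = "{a..b} \<inter> \<gamma> -` chart_dom c"
    obtain V where cV: "continuous_on ?I V"
      and dV: "\<forall>t\<in>?I. ((snd c \<circ> \<gamma>) has_vector_derivative V t) (at t within {a..b}) \<and> R c (\<gamma> t) (V t)"
      using V[OF c] by blast
    have eq: "velocity c \<gamma> a b t = V t" if "t \<in> ?I" for t
      unfolding velocity_def
      using that dV by (intro vector_derivative_within_closed_interval[OF \<open>a < b\<close>]) simp_all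
    have "continuous_on ?I (velocity c \<gamma> a b)"
      using continuous_on_cong[of ?I ?I "velocity c \<gamma> a b" V, OF refl eq] cV by blast
    moreover have "(snd c \<circ> \<gamma>) differentiable (at t within {a..b})" if "t \<in> ?I" for t
      using dV that differentiableI_vector by blast
    ultimately show ?thesis
      using dV eq by simp
  qed
  then show ?thesis
    using assms(1,2) unfolding segment_with_def C1_segment_def by simp
qed

lemma segment_with_less: "segment_with R M \<gamma> a b \<Longrightarrow> a < b"
  by (simp add: segment_with_def C1_segment_def)

lemma segment_with_continuous: "segment_with R M \<gamma> a b \<Longrightarrow> continuous_on {a..b} \<gamma>"
  by (simp add: segment_with_def C1_segment_def)

lemma segment_with_velocity:
  assumes "segment_with R M \<gamma> a b" "c \<in> atlas M"
  shows "continuous_on ({a..b} \<inter> \<gamma> -` chart_dom c) (velocity c \<gamma> a b)"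
    and "t \<in> {a..b} \<Longrightarrow> \<gamma> t \<in> chart_dom c \<Longrightarrow>
      ((snd c \<circ> \<gamma>) has_vector_derivative velocity c \<gamma> a b t) (at t within {a..b})"
    and "t \<in> {a..b} \<Longrightarrow> \<gamma> t \<in> chart_dom c \<Longrightarrow> R c (\<gamma> t) (velocity c \<gamma> a b t)"
  using assms
  by (auto simp: segment_with_def C1_segment_def velocity_def vector_derivative_works[symmetric])

text \<open>
  Restriction to a subinterval, shift of the parameter, and passage to a curve that agrees only on the
  interval in question, all at once.
\<close>

lemma segment_with_transfer:
  assumes \<gamma>: "segment_with R M \<gamma> a b" and "s < t" "{s + k..t + k} \<subseteq> {a..b}"
    and \<delta>: "\<And>\<tau>. \<tau> \<in> {s..t} \<Longrightarrow> \<delta> \<tau> = \<gamma> (\<tau> + k)"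
  shows "segment_with R M \<delta> s t"
proof (rule segment_withI)
  have shift: "(\<lambda>\<tau>. \<tau> + k) ` {s..t} \<subseteq> {a..b}"
    using assms(3) by auto
  have "continuous_on {s..t} (\<lambda>\<tau>. \<gamma> (\<tau> + k))"
    by (rule continuous_on_compose2[OF segment_with_continuous[OF \<gamma>] _ shift])
      (intro continuous_intros)
  then show "continuous_on {s..t} \<delta>"
    using continuous_on_cong[of "{s..t}" "{s..t}" \<delta> "\<lambda>\<tau>. \<gamma> (\<tau> + k)", OF refl \<delta>] by blast
  fix c assume c: "c \<in> atlas M"
  let ?V = "\<lambda>\<tau>. velocity c \<gamma> a b (\<tau> + k)"
  have "continuous_on ({s..t} \<inter> \<delta> -` chart_dom c) ?V"
  proof (rule continuous_on_compose2[OF segment_with_velocity(1)[OF \<gamma> c]])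
    show "(\<lambda>\<tau>. \<tau> + k) ` ({s..t} \<inter> \<delta> -` chart_dom c) \<subseteq> {a..b} \<inter> \<gamma> -` chart_dom c"
      using shift \<delta> by fastforce
  qed (intro continuous_intros)
  moreover have "((snd c \<circ> \<delta>) has_vector_derivative ?V \<tau>) (at \<tau> within {s..t}) \<and> R c (\<delta> \<tau>) (?V \<tau>)"
    if \<tau>: "\<tau> \<in> {s..t}" "\<delta> \<tau> \<in> chart_dom c" for \<tau>
  proof -
    have in_ab: "\<tau> + k \<in> {a..b}" and dom: "\<gamma> (\<tau> + k) \<in> chart_dom c"
      using \<tau> shift \<delta> by auto
    have "((snd c \<circ> \<gamma>) has_vector_derivative ?V \<tau>) (at (\<tau> + k) within (\<lambda>\<tau>. \<tau> + k) ` {s..t})"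
      by (rule has_vector_derivative_within_subset[OF segment_with_velocity(2)[OF \<gamma> c in_ab dom] shift])
    moreover have "((\<lambda>\<tau>. \<tau> + k) has_vector_derivative 1) (at \<tau> within {s..t})"
      by (auto intro!: derivative_eq_intros)
    ultimately have "((snd c \<circ> \<gamma> \<circ> (\<lambda>\<tau>. \<tau> + k)) has_vector_derivative 1 *\<^sub>R ?V \<tau>) (at \<tau> within {s..t})"
      by (intro vector_diff_chain_within)
    then have "((snd c \<circ> \<delta>) has_vector_derivative ?V \<tau>) (at \<tau> within {s..t})"
      using \<tau>(1) \<delta> by (intro has_vector_derivative_transform[of \<tau> "{s..t}" "snd c \<circ> \<delta>"]) auto
    then show ?thesis
      using segment_with_velocity(3)[OF \<gamma> c in_ab dom] \<delta> \<tau>(1) by simp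
  qed
  ultimately show "\<exists>V. continuous_on ({s..t} \<inter> \<delta> -` chart_dom c) V \<and>
      (\<forall>\<tau>\<in>{s..t} \<inter> \<delta> -` chart_dom c.
        ((snd c \<circ> \<delta>) has_vector_derivative V \<tau>) (at \<tau> within {s..t}) \<and> R c (\<delta> \<tau>) (V \<tau>))"
    by (intro exI[of _ ?V]) auto
qed (rule \<open>s < t\<close>)

lemma piecewise_single: "P \<gamma> a b \<Longrightarrow> a < b \<Longrightarrow> piecewise P \<gamma> a b"
  unfolding piecewise_def by (intro exI[of _ 1] exI[of _ "\<lambda>i. if i = 0 then a else b"]) auto

lemma piecewise_snoc:
  assumes "piecewise P \<gamma> a b" "P \<gamma> b d" "b < d"
  shows "piecewise P \<gamma> a d"
proof -
  obtain n s where s: "0 < n" "s 0 = a" "s n = b" "\<forall>i<n. s i < s (Suc i) \<and> P \<gamma> (s i) (s (Suc i))"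
    using assms(1) unfolding piecewise_def by blast
  then show ?thesis
    unfolding piecewise_def using assms(2,3)
    by (intro exI[of _ "Suc n"] exI[of _ "s(Suc n := d)"]) (auto simp: less_Suc_eq)
qed

lemma strict_mono_of_steps:
  fixes s :: "nat \<Rightarrow> real"
  assumes "\<And>i. i < n \<Longrightarrow> s i < s (Suc i)" "i < j" "j \<le> n"
  shows "s i < s j"
  using assms(2,3)
proof (induction j)
  case (Suc j)
  then show ?case
    using assms(1)[of j] by (cases "i = j") auto
qed simp

lemma piecewise_mono:
  assumes "piecewise P \<gamma> a b"
    and "\<And>s t. s < t \<Longrightarrow> {s..t} \<subseteq> {a..b} \<Longrightarrow> P \<gamma> s t \<Longrightarrow> Q \<delta> s t"
  shows "piecewise Q \<delta> a b"
proof -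
  obtain n s where s: "0 < n" "s 0 = a" "s n = b" "\<And>i. i < n \<Longrightarrow> s i < s (Suc i) \<and> P \<gamma> (s i) (s (Suc i))"
    using assms(1) unfolding piecewise_def by blast
  have less: "s i < s j" if "i < j" "j \<le> n" for i j
    by (rule strict_mono_of_steps[of n s]) (use s(4) that in simp_all)
  have "Q \<delta> (s i) (s (Suc i))" if "i < n" for i
  proof (rule assms(2))
    have "a \<le> s i" "s (Suc i) \<le> b"
      using less[of 0 i] less[of "Suc i" n] s(2,3) that
      by (cases "i = 0"; cases "Suc i = n"; simp)+
    then show "{s i..s (Suc i)} \<subseteq> {a..b}" by auto
  qed (use s(4) that in auto)
  then show ?thesis
    unfolding piecewise_def using s by blast
qed

lemma piecewise_less:
  assumes "piecewise P \<gamma> a b"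
  shows "a < b"
proof -
  obtain n s where "0 < n" "s 0 = a" "s n = b" "\<And>i. i < n \<Longrightarrow> s i < s (Suc i)"
    using assms unfolding piecewise_def by blast
  then show ?thesis
    using strict_mono_of_steps[of n s 0 n] by simp
qed

text \<open>
  Besides transitivity of both relations, this gives a closed causal curve through two points that
  precede each other; for that purpose the first curve must survive as an initial piece of the joined one.
\<close>

lemma piecewise_segment_append:
  assumes \<gamma>: "piecewise (segment_with R M) \<gamma> a b" and \<delta>: "piecewise (segment_with R M) \<delta> c d"
    and "\<gamma> b = \<delta> c"
  obtains \<kappa> e where "piecewise (segment_with R M) \<kappa> a e" "\<And>t. t \<le> b \<Longrightarrow> \<kappa> t = \<gamma> t" "b < e" "\<kappa> e = \<delta> d"
proof -
  \<comment> \<open>The second curve is moved so that its parameter \<open>c\<close> becomes \<open>b\<close>; the two pieces agree at \<open>b\<close>.\<close>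
  define \<kappa> where "\<kappa> = (\<lambda>t. if t \<le> b then \<gamma> t else \<delta> (t + (c - b)))"
  have \<kappa>2: "\<kappa> t = \<delta> (t + (c - b))" if "b \<le> t" for t
    using that assms(3) by (auto simp: \<kappa>_def)
  obtain n s where s: "0 < n" "s 0 = c" "s n = d"
      "\<And>i. i < n \<Longrightarrow> s i < s (Suc i) \<and> segment_with R M \<delta> (s i) (s (Suc i))"
    using \<delta> unfolding piecewise_def by blast
  have pos: "c \<le> s i" if "i \<le> n" for i
  proof (cases "i = 0")
    case False
    have "s 0 < s i"
      by (rule strict_mono_of_steps[of n s]) (use s(4) that False in simp_all)
    then show ?thesis
      using s(2) by simp
  qed (use s(2) in simp)
  have start: "piecewise (segment_with R M) \<kappa> a b"
  proof (rule piecewise_mono[OF \<gamma>])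
    fix t u :: real
    assume tu: "t < u" "{t..u} \<subseteq> {a..b}" "segment_with R M \<gamma> t u"
    show "segment_with R M \<kappa> t u"
      by (rule segment_with_transfer[OF tu(3,1), where k = 0]) (use tu(2) in \<open>auto simp: \<kappa>_def\<close>)
  qed
  have "piecewise (segment_with R M) \<kappa> a (s i - (c - b))" if "i \<le> n" for i
    using that
  proof (induction i)
    case (Suc i)
    show ?case
    proof (rule piecewise_snoc)
      show "segment_with R M \<kappa> (s i - (c - b)) (s (Suc i) - (c - b))"
        by (rule segment_with_transfer[where k = "c - b" and \<gamma> = \<delta>, OF _ _ _ \<kappa>2])
          (use s(4)[of i] Suc.prems pos[of i] in auto)
    qed (use Suc s(4)[of i] in simp_all)
  qed (use start s(2) in simp)
  from this[of n] have "piecewise (segment_with R M) \<kappa> a (d - (c - b))"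
    using s by simp
  moreover have "c < d"
    using piecewise_less[OF \<delta>] .
  ultimately show thesis
    by (intro that[of \<kappa> "d - (c - b)"]) (auto simp: \<kappa>_def)
qed

lemma timelike_curve_eq: "timelike_curve M = piecewise (segment_with (future_timelike M) M)"
  by (simp add: timelike_curve_def timelike_segment_eq)

lemma causal_curve_eq: "causal_curve M = piecewise (segment_with (future_causal M) M)"
  by (simp add: causal_curve_def causal_segment_eq)

lemma chronological_trans:
  assumes "chronological M p q" "chronological M q r"
  shows "chronological M p r"
proof -
  from assms obtain \<gamma> a b \<delta> c d where *: "timelike_curve M \<gamma> a b" "\<gamma> a = p" "\<gamma> b = q"
    "timelike_curve M \<delta> c d" "\<delta> c = q" "\<delta> d = r"
    unfolding chronological_def by blast
  then obtain \<kappa> e where \<kappa>: "timelike_curve M \<kappa> a e" "\<And>t. t \<le> b \<Longrightarrow> \<kappa> t = \<gamma> t" "\<kappa> e = \<delta> d"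
    unfolding timelike_curve_eq
    using piecewise_segment_append[of "future_timelike M" M \<gamma> a b \<delta> c d] by metis
  have "a < b"
    using *(1) unfolding timelike_curve_eq by (rule piecewise_less)
  then have "\<kappa> a = p" "\<kappa> e = r"
    using \<kappa> * by auto
  then show ?thesis
    unfolding chronological_def using \<kappa>(1) by blast
qed

lemma causal_refl: "causal M p p"
  by (simp add: causal_def)

lemma causal_trans:
  assumes "causal M p q" "causal M q r"
  shows "causal M p r"
proof (cases "p = q \<or> q = r")
  case False
  with assms obtain \<gamma> a b \<delta> c d where *: "causal_curve M \<gamma> a b" "\<gamma> a = p" "\<gamma> b = q"
    "causal_curve M \<delta> c d" "\<delta> c = q" "\<delta> d = r"
    unfolding causal_def by blast
  then obtain \<kappa> e where \<kappa>: "causal_curve M \<kappa> a e" "\<And>t. t \<le> b \<Longrightarrow> \<kappa> t = \<gamma> t" "\<kappa> e = \<delta> d"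
    unfolding causal_curve_eq
    using piecewise_segment_append[of "future_causal M" M \<gamma> a b \<delta> c d] by metis
  have "a < b"
    using *(1) unfolding causal_curve_eq by (rule piecewise_less)
  then have "\<kappa> a = p" "\<kappa> e = r"
    using \<kappa> * by auto
  then show ?thesis
    unfolding causal_def using \<kappa>(1) by blast
qed (use assms in auto)

lemma chronological_imp_causal:
  assumes "chronological M p q" and bilin: "\<And>c p. c \<in> atlas M \<Longrightarrow> p \<in> chart_dom c \<Longrightarrow> bilinear (metric M c p)"
  shows "causal M p q"
proof -
  have seg: "segment_with (future_causal M) M \<gamma> a b" if "segment_with (future_timelike M) M \<gamma> a b" for \<gamma> a b
  proof -
    have "future_causal M c x v" if "future_timelike M c x v" "c \<in> atlas M" "x \<in> chart_dom c" for c x v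
      using that(1) bilinear_lzero[OF bilin[OF that(2,3)]]
      by (auto simp: future_causal_def future_timelike_def)
    then show ?thesis
      using that unfolding segment_with_def by blast
  qed
  have "causal_curve M \<gamma> a b" if "timelike_curve M \<gamma> a b" for \<gamma> a b
    unfolding causal_curve_eq
    by (rule piecewise_mono[OF that[unfolded timelike_curve_eq]]) (rule seg)
  then show ?thesis
    using assms(1) unfolding chronological_def causal_def by blast
qed

text \<open>
  A closed causal curve through \<open>p\<close> and \<open>q\<close> starts and ends at \<open>p\<close>, so strong causality confines it to any
  given neighbourhood of \<open>p\<close>, in particular to one that omits \<open>q\<close>.
\<close>

lemma strongly_causal_imp_antisym:
  fixes M :: "('m::t2_space, 'e::euclidean_space) spacetime"
  assumes "strongly_causal M" "causal M p q" "causal M q p"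
  shows "p = q"
proof (rule ccontr)
  assume "p \<noteq> q"
  with assms obtain \<gamma> a b \<delta> c d where *: "causal_curve M \<gamma> a b" "\<gamma> a = p" "\<gamma> b = q"
    "causal_curve M \<delta> c d" "\<delta> c = q" "\<delta> d = p"
    unfolding causal_def by blast
  then obtain \<kappa> e where \<kappa>: "causal_curve M \<kappa> a e" "\<And>t. t \<le> b \<Longrightarrow> \<kappa> t = \<gamma> t" "b < e" "\<kappa> e = \<delta> d"
    unfolding causal_curve_eq
    using piecewise_segment_append[of "future_causal M" M \<gamma> a b \<delta> c d] by metis
  have "a < b"
    using *(1) piecewise_less unfolding causal_curve_eq by blast
  obtain U where U: "open U" "p \<in> U" "q \<notin> U"
    using \<open>p \<noteq> q\<close> t1_space by blast
  then obtain V where "p \<in> V"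
    "\<And>\<gamma> a b. causal_curve M \<gamma> a b \<Longrightarrow> \<gamma> a \<in> V \<Longrightarrow> \<gamma> b \<in> V \<Longrightarrow> \<gamma> ` {a..b} \<subseteq> U"
    using assms(1) unfolding strongly_causal_def by metis
  then have "\<kappa> ` {a..e} \<subseteq> U"
    using \<kappa> * \<open>a < b\<close> by simp
  moreover have "\<kappa> b = q" "b \<in> {a..e}"
    using \<kappa> * \<open>a < b\<close> by auto
  ultimately show False
    using U by blast
qed

section \<open>Elementary analysis\<close>

lemma small_scale:
  fixes A B K :: real
  assumes "0 < A" "0 < B" "0 \<le> K"
  shows "\<exists>l>0. l < A \<and> l * K < B"
proof -
  define l where "l = min (A / 2) (B / (K + 1))"
  have "l > 0"
    using assms by (simp add: l_def)
  have "l \<le> A / 2" "l \<le> B / (K + 1)"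
    unfolding l_def by (rule min.cobounded1, rule min.cobounded2)
  then have "l < A"
    using assms(1) by simp
  moreover have "l * K < B"
  proof -
    have "l * (K + 1) \<le> B"
      using \<open>l \<le> B / (K + 1)\<close> assms(3) by (simp add: pos_le_divide_eq)
    then show ?thesis
      using \<open>l > 0\<close> by (simp add: algebra_simps)
  qed
  ultimately show ?thesis
    using \<open>l > 0\<close> by blast
qed

lemma eventually_nhds_prod_dist:
  fixes x :: "'a::metric_space" and v :: "'b::metric_space"
  assumes "\<forall>\<^sub>F z in nhds x \<times>\<^sub>F nhds v. P z"
  obtains \<eta> where "\<eta> > 0" "\<And>y w. dist y x < \<eta> \<Longrightarrow> dist w v < \<eta> \<Longrightarrow> P (y, w)"
proof -
  obtain Pf Pg where P: "eventually Pf (nhds x)" "eventually Pg (nhds v)"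
    "\<And>y w. Pf y \<Longrightarrow> Pg w \<Longrightarrow> P (y, w)"
    using assms unfolding eventually_prod_filter by blast
  then obtain d e where "d > 0" "\<And>y. dist y x < d \<Longrightarrow> Pf y" "e > 0" "\<And>w. dist w v < e \<Longrightarrow> Pg w"
    unfolding eventually_nhds_metric by blast
  with P(3) show thesis
    by (intro that[of "min d e"]) auto
qed

lemma continuous_on_nearby:
  fixes f :: "real \<Rightarrow> 'a::topological_space"
  assumes "continuous_on I f" "t0 \<in> I" "open U" "f t0 \<in> U"
  obtains d where "d > 0" "\<And>t. t \<in> I \<Longrightarrow> \<bar>t - t0\<bar> < d \<Longrightarrow> f t \<in> U"
proof -
  have "(f \<longlongrightarrow> f t0) (at t0 within I)"
    using assms(1,2) by (simp add: continuous_on_def)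
  then have "\<forall>\<^sub>F t in at t0 within I. f t \<in> U"
    using assms(3,4) by (rule topological_tendstoD)
  then obtain d where d: "d > 0" "\<forall>t\<in>I. t \<noteq> t0 \<and> dist t t0 < d \<longrightarrow> f t \<in> U"
    unfolding eventually_at by blast
  have "f t \<in> U" if "t \<in> I" "\<bar>t - t0\<bar> < d" for t
    using d(2) that assms(4) by (cases "t = t0") (auto simp: dist_real_def)
  with d(1) show thesis
    using that by blast
qed

lemma linear_Basis_expansion:
  fixes f :: "'e::euclidean_space \<Rightarrow> 'f::real_vector"
  assumes "linear f"
  shows "f v = (\<Sum>i\<in>Basis. (v \<bullet> i) *\<^sub>R f i)"
proof -
  have "f v = f (\<Sum>i\<in>Basis. (v \<bullet> i) *\<^sub>R i)"
    by (simp add: euclidean_representation)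
  also have "\<dots> = (\<Sum>i\<in>Basis. (v \<bullet> i) *\<^sub>R f i)"
    by (simp add: linear_sum[OF assms] linear_scale[OF assms])
  finally show ?thesis .
qed

lemma bilinear_Basis_expansion:
  fixes b :: "'e::euclidean_space \<Rightarrow> 'e \<Rightarrow> real"
  assumes "bilinear b"
  shows "b u v = (\<Sum>i\<in>Basis. \<Sum>j\<in>Basis. (u \<bullet> i) * (v \<bullet> j) * b i j)"
proof -
  have lin: "linear (\<lambda>x. b x v)" "linear (b i)" for v i
    using assms by (auto simp: bilinear_def)
  have "b u v = (\<Sum>i\<in>Basis. (u \<bullet> i) * b i v)"
    using linear_Basis_expansion[OF lin(1)[of v], of u] by simp
  also have "\<dots> = (\<Sum>i\<in>Basis. (u \<bullet> i) * (\<Sum>j\<in>Basis. (v \<bullet> j) * b i j))"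
    using linear_Basis_expansion[OF lin(2), of _ v] by simp
  finally show ?thesis
    by (simp add: sum_distrib_left mult.assoc)
qed

lemma chronologicalI: "timelike_segment M \<gamma> a b \<Longrightarrow> chronological M (\<gamma> a) (\<gamma> b)"
  unfolding chronological_def timelike_curve_eq timelike_segment_eq
  using piecewise_single segment_with_less by blast

text \<open>
  The form is symmetric on an orthonormal basis, hence everywhere by bilinearity.
\<close>

lemma lorentzian_form_sym:
  assumes "lorentzian_form b"
  shows "b u v = b v u"
proof -
  obtain B e where bil: "bilinear b" and B: "span B = UNIV" and
    orth: "\<forall>u\<in>B. \<forall>v\<in>B. b u v = (if u \<noteq> v then 0 else if u = e then - 1 else 1)"
    using assms unfolding lorentzian_form_def by blast
  have "bilinear (\<lambda>u v. b v u)"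
    using bil by (simp add: bilinear_def)
  then show ?thesis
    by (rule bilinear_eq[OF bil, of _ UNIV B UNIV B]) (use B orth in auto)
qed

section \<open>A spacetime in one chart\<close>

text \<open>
  Everything is transported to the open coordinate domain \<open>S\<close> of one chart, where the metric \<open>G\<close> and the
  time field \<open>W\<close> become functions of a point of the model space.
\<close>

locale coordinate_chart =
  fixes M :: "('m::{t2_space,second_countable_topology}, 'e::euclidean_space) spacetime"
    and c :: "('m, 'e) chart"
  assumes spacetime: "smooth_spacetime M" and chart: "c \<in> atlas M"
begin

definition S where "S = snd c ` chart_dom c"
definition G where "G x v w = metric M c (chart_inv c x) v w"
definition W where "W x = time_field M c (chart_inv c x)"

lemma atlas: "smooth_atlas (atlas M)"
  using spacetime by (simp add: smooth_spacetime_def)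

lemma lorentzian_metric: "lorentzian_metric M"
  using spacetime by (simp add: smooth_spacetime_def)

lemma time_orientation: "time_orientation M"
  using spacetime by (simp add: smooth_spacetime_def)

lemma is_chart: "is_chart c"
  using atlas chart by (simp add: smooth_atlas_def)

lemma open_S: "open S"
  using is_chart by (simp add: is_chart_def S_def)

lemma open_dom: "open (chart_dom c)"
  using is_chart by (simp add: is_chart_def)

lemma homeo: "homeomorphism (chart_dom c) S (snd c) (chart_inv c)"
  using is_chart by (simp add: is_chart_def S_def)

lemma continuous_coord: "continuous_on (chart_dom c) (snd c)"
  using homeo by (simp add: homeomorphism_def)

lemma continuous_inv: "continuous_on S (chart_inv c)"
  using homeo by (simp add: homeomorphism_def)

lemma coord_in: "p \<in> chart_dom c \<Longrightarrow> snd c p \<in> S"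
  by (simp add: S_def)

lemma inv_coord [simp]: "p \<in> chart_dom c \<Longrightarrow> chart_inv c (snd c p) = p"
  using homeo by (simp add: homeomorphism_def)

lemma inv_in: "x \<in> S \<Longrightarrow> chart_inv c x \<in> chart_dom c"
  unfolding S_def by (rule inv_into_into)

lemma coord_inv [simp]: "x \<in> S \<Longrightarrow> snd c (chart_inv c x) = x"
  unfolding S_def by (rule f_inv_into_f)

lemma metric_eq: "p \<in> chart_dom c \<Longrightarrow> metric M c p = G (snd c p)"
  by (simp add: G_def fun_eq_iff)

lemma time_field_eq: "p \<in> chart_dom c \<Longrightarrow> time_field M c p = W (snd c p)"
  by (simp add: W_def)

lemma G_lorentzian: "x \<in> S \<Longrightarrow> lorentzian_form (G x)"
  using lorentzian_metric chart inv_in[of x]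
  unfolding lorentzian_metric_def G_def[abs_def] by blast

lemma G_bilinear: "x \<in> S \<Longrightarrow> bilinear (G x)"
  using G_lorentzian by (simp add: lorentzian_form_def)

lemma G_smooth: "smooth_on S (\<lambda>x. G x v w)"
  using lorentzian_metric chart unfolding lorentzian_metric_def G_def S_def by blast

lemma G_continuous: "continuous_on S (\<lambda>x. G x v w)"
  using G_smooth[of v w] unfolding smooth_on_def by (auto dest: spec[of _ 0])

lemma G_differentiable: "x \<in> S \<Longrightarrow> (\<lambda>x. G x v w) differentiable (at x)"
  using G_smooth[of v w] unfolding smooth_on_def by (auto dest: spec[of _ 1])

lemma G_derivative_continuous: "continuous_on S (\<lambda>x. frechet_derivative (\<lambda>x. G x v w) (at x) z)"
  using G_smooth[of v w] unfolding smooth_on_def by (auto dest: spec[of _ 1])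

lemma tendsto_on_S:
  assumes "continuous_on S f" "x0 \<in> S" "(X \<longlongrightarrow> x0) F"
  shows "((\<lambda>z. f (X z)) \<longlongrightarrow> f x0) F"
  using assms open_S by (simp add: continuous_on_eq_continuous_at isCont_tendsto_compose)

text \<open>
  Joint continuity of \<open>g\<close> in base point and both vectors: expanding in the standard basis reduces it to
  the smoothness of the finitely many coefficients.
\<close>

lemma G_tendsto:
  assumes x0: "x0 \<in> S" and X: "(X \<longlongrightarrow> x0) F" and "(u \<longlongrightarrow> u0) F" "(v \<longlongrightarrow> v0) F"
  shows "((\<lambda>z. G (X z) (u z) (v z)) \<longlongrightarrow> G x0 u0 v0) F"
proof -
  have "((\<lambda>z. \<Sum>i\<in>Basis. \<Sum>j\<in>Basis. (u z \<bullet> i) * (v z \<bullet> j) * G (X z) i j) \<longlongrightarrow>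
      (\<Sum>i\<in>Basis. \<Sum>j\<in>Basis. (u0 \<bullet> i) * (v0 \<bullet> j) * G x0 i j)) F"
    by (intro tendsto_intros assms tendsto_on_S[OF G_continuous x0 X])
  moreover have "\<forall>\<^sub>F z in F. (\<Sum>i\<in>Basis. \<Sum>j\<in>Basis. (u z \<bullet> i) * (v z \<bullet> j) * G (X z) i j) =
      G (X z) (u z) (v z)"
    using topological_tendstoD[OF X open_S x0]
    by eventually_elim (rule bilinear_Basis_expansion[OF G_bilinear, symmetric])
  ultimately show ?thesis
    using bilinear_Basis_expansion[OF G_bilinear[OF x0], of u0 v0] by (simp add: tendsto_cong)
qed

lemma W_tendsto:
  assumes "x0 \<in> S" "(X \<longlongrightarrow> x0) F"
  shows "((\<lambda>z. W (X z)) \<longlongrightarrow> W x0) F"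
proof -
  have "continuous_on (chart_dom c) (time_field M c)"
    using time_orientation chart unfolding time_orientation_def by blast
  then have "continuous_on S W"
    unfolding W_def by (rule continuous_on_compose2[OF _ continuous_inv]) (use inv_in in auto)
  then show ?thesis
    using assms by (rule tendsto_on_S)
qed

lemma W_timelike: "x \<in> S \<Longrightarrow> G x (W x) (W x) < 0"
  using time_orientation chart inv_in[of x] unfolding time_orientation_def G_def W_def by blast

lemma future_timelike_chart:
  "x \<in> S \<Longrightarrow> future_timelike M c (chart_inv c x) v \<longleftrightarrow> G x v v < 0 \<and> G x v (W x) < 0"
  by (simp add: future_timelike_def G_def W_def)

lemma future_timelike_stable:
  assumes x0: "x0 \<in> S" and "future_timelike M c (chart_inv c x0) v0"
  obtains \<eta> where "\<eta> > 0"
    "\<And>x v. dist x x0 < \<eta> \<Longrightarrow> dist v v0 < \<eta> \<Longrightarrow> x \<in> S \<and> future_timelike M c (chart_inv c x) v"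
proof -
  let ?F = "nhds x0 \<times>\<^sub>F nhds v0"
  have neg: "G x0 v0 v0 < 0" "G x0 v0 (W x0) < 0"
    using assms by (simp_all add: future_timelike_chart)
  have "\<forall>\<^sub>F z in ?F. fst z \<in> S"
    using filterlim_fst open_S x0 by (rule topological_tendstoD)
  moreover have "\<forall>\<^sub>F z in ?F. G (fst z) (snd z) (snd z) < 0"
    using neg(1) by (intro order_tendstoD(2)[OF G_tendsto[OF x0 filterlim_fst filterlim_snd filterlim_snd]])
  moreover have "\<forall>\<^sub>F z in ?F. G (fst z) (snd z) (W (fst z)) < 0"
    using neg(2)
    by (intro order_tendstoD(2)[OF G_tendsto[OF x0 filterlim_fst filterlim_snd W_tendsto[OF x0 filterlim_fst]]])
  ultimately have "\<forall>\<^sub>F z in ?F. fst z \<in> S \<and> future_timelike M c (chart_inv c (fst z)) (snd z)"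
    by eventually_elim (simp add: future_timelike_chart)
  then show thesis
    by (rule eventually_nhds_prod_dist) (use that in auto)
qed

text \<open>
  Whether a curve inside one chart is timelike can be decided in that chart: by the chain rule its velocity in
  another chart is the image under the Jacobian, which depends continuously on the point, and metric and
  time field transform with the same Jacobian.
\<close>

lemma timelike_segment_chart:
  assumes "a < b"
    and S: "\<And>t. t \<in> {a..b} \<Longrightarrow> \<sigma> t \<in> S"
    and \<sigma>: "\<And>t. t \<in> {a..b} \<Longrightarrow> (\<sigma> has_vector_derivative V t) (at t within {a..b})"
    and V: "continuous_on {a..b} V"
    and fut: "\<And>t. t \<in> {a..b} \<Longrightarrow> future_timelike M c (chart_inv c (\<sigma> t)) (V t)"
  shows "timelike_segment M (chart_inv c \<circ> \<sigma>) a b"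
  unfolding timelike_segment_eq
proof (rule segment_withI[OF \<open>a < b\<close>])
  let ?\<gamma> = "chart_inv c \<circ> \<sigma>"
  have cont_\<sigma>: "continuous_on {a..b} \<sigma>"
    unfolding continuous_on_eq_continuous_within using \<sigma> has_vector_derivative_continuous by blast
  show "continuous_on {a..b} ?\<gamma>"
    unfolding o_def by (rule continuous_on_compose2[OF continuous_inv cont_\<sigma>]) (use S in blast)
  fix d assume d: "d \<in> atlas M"
  let ?I = "{a..b} \<inter> ?\<gamma> -` chart_dom d"
  let ?D = "\<lambda>x. frechet_derivative (coord_change c d) (at x)"
  define overlap where "overlap = snd c ` (chart_dom c \<inter> chart_dom d)"
  have smooth: "smooth_on overlap (coord_change c d)"
    using atlas chart d by (simp add: smooth_atlas_def overlap_def)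
  have diff: "coord_change c d differentiable (at x)" if "x \<in> overlap" for x
    using smooth that unfolding smooth_on_def by (auto dest: spec[of _ 1])
  have cont_D: "continuous_on overlap (\<lambda>x. ?D x v)" for v
    using smooth unfolding smooth_on_def by (auto dest: spec[of _ 1])
  have in_overlap: "\<sigma> t \<in> overlap" if "t \<in> ?I" for t
    unfolding overlap_def using that S inv_in[of "\<sigma> t"]
    by (intro image_eqI[of _ _ "chart_inv c (\<sigma> t)"]) auto
  let ?V = "\<lambda>t. ?D (\<sigma> t) (V t)"
  have sum: "continuous_on ?I (\<lambda>t. \<Sum>i\<in>Basis. (V t \<bullet> i) *\<^sub>R ?D (\<sigma> t) i)"
    using in_overlap
    by (intro continuous_intros continuous_on_compose2[OF cont_D]
        continuous_on_subset[OF V] continuous_on_subset[OF cont_\<sigma>]) auto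
  have expand: "?V t = (\<Sum>i\<in>Basis. (V t \<bullet> i) *\<^sub>R ?D (\<sigma> t) i)" if "t \<in> ?I" for t
    by (rule linear_Basis_expansion[OF linear_frechet_derivative[OF diff[OF in_overlap[OF that]]]])
  have "continuous_on ?I ?V"
    using continuous_on_cong[OF refl expand] sum by (rule iffD2)
  moreover have "((snd d \<circ> ?\<gamma>) has_vector_derivative ?V t) (at t within {a..b}) \<and>
      future_timelike M d (?\<gamma> t) (?V t)" if t: "t \<in> ?I" for t
  proof
    have t': "t \<in> {a..b}" and p: "?\<gamma> t \<in> chart_dom c \<inter> chart_dom d"
      using t S inv_in by auto
    have "(coord_change c d has_derivative ?D (\<sigma> t)) (at (\<sigma> t))"
      using diff[OF in_overlap[OF t]] unfolding frechet_derivative_works .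
    then have "((coord_change c d \<circ> \<sigma>) has_vector_derivative ?V t) (at t within {a..b})"
      by (rule vector_derivative_diff_chain_within[OF \<sigma>[OF t'] has_derivative_at_withinI])
    then show "((snd d \<circ> ?\<gamma>) has_vector_derivative ?V t) (at t within {a..b})"
      by (simp add: coord_change_def o_assoc)
    have J: "jacobian c d (?\<gamma> t) = ?D (\<sigma> t)"
      using S t' by (simp add: jacobian_def)
    have "metric M c (?\<gamma> t) v w = metric M d (?\<gamma> t) (?D (\<sigma> t) v) (?D (\<sigma> t) w)"
      and "time_field M d (?\<gamma> t) = ?D (\<sigma> t) (time_field M c (?\<gamma> t))" for v w
      using lorentzian_metric time_orientation chart d p
      unfolding J[symmetric] lorentzian_metric_def time_orientation_def by blast+
    then show "future_timelike M d (?\<gamma> t) (?V t)"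
      using fut[OF t'] by (simp add: future_timelike_def)
  qed
  ultimately show "\<exists>V. continuous_on ?I V \<and> (\<forall>t\<in>?I.
      ((snd d \<circ> ?\<gamma>) has_vector_derivative V t) (at t within {a..b}) \<and> future_timelike M d (?\<gamma> t) (V t))"
    by (intro exI[of _ ?V]) simp
qed

lemma chronological_line:
  assumes "l > 0"
    and line: "\<And>\<tau>. \<tau> \<in> {0..l} \<Longrightarrow> x + \<tau> *\<^sub>R v \<in> S \<and> future_timelike M c (chart_inv c (x + \<tau> *\<^sub>R v)) v"
  shows "chronological M (chart_inv c x) (chart_inv c (x + l *\<^sub>R v))"
proof -
  have "timelike_segment M (chart_inv c \<circ> (\<lambda>\<tau>. x + \<tau> *\<^sub>R v)) 0 l"
  proof (rule timelike_segment_chart[OF \<open>l > 0\<close>])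
    show "((\<lambda>\<tau>. x + \<tau> *\<^sub>R v) has_vector_derivative v) (at t within {0..l})" for t
      by (auto intro!: derivative_eq_intros)
  qed (use line in auto)
  from chronologicalI[OF this] show ?thesis
    by simp
qed

text \<open>
  If \<open>v\<^sub>0\<close> is future timelike at \<open>x\<^sub>0\<close>, then so is every vector near \<open>v\<^sub>0\<close> at every point near \<open>x\<^sub>0\<close>. Hence a
  straight segment near \<open>x\<^sub>0\<close> whose mean velocity is close to \<open>v\<^sub>0\<close> is a timelike curve; it stays near \<open>x\<^sub>0\<close>
  because balls are convex.
\<close>

lemma chronological_near_timelike_vector:
  assumes x0: "x0 \<in> S" and "future_timelike M c (chart_inv c x0) v0"
  obtains \<eta> where "\<eta> > 0" "ball x0 \<eta> \<subseteq> S"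
    "\<And>x y l. dist x x0 < \<eta> \<Longrightarrow> dist y x0 < \<eta> \<Longrightarrow> l > 0 \<Longrightarrow>
      norm (y - x - l *\<^sub>R v0) < l * \<eta> \<Longrightarrow> chronological M (chart_inv c x) (chart_inv c y)"
proof -
  obtain \<eta> where \<eta>: "\<eta> > 0"
    "\<And>x v. dist x x0 < \<eta> \<Longrightarrow> dist v v0 < \<eta> \<Longrightarrow> x \<in> S \<and> future_timelike M c (chart_inv c x) v"
    using future_timelike_stable[OF assms] by metis
  have "chronological M (chart_inv c x) (chart_inv c y)"
    if xy: "dist x x0 < \<eta>" "dist y x0 < \<eta>" and l: "l > 0" "norm (y - x - l *\<^sub>R v0) < l * \<eta>" for x y l
  proof -
    define v where "v = (1 / l) *\<^sub>R (y - x)"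
    have "v - v0 = (1 / l) *\<^sub>R (y - x - l *\<^sub>R v0)"
      using l(1) by (simp add: v_def scaleR_diff_right)
    then have "norm (v - v0) = norm (y - x - l *\<^sub>R v0) / l"
      using l(1) by simp
    also have "\<dots> < \<eta>"
      using l by (simp add: pos_divide_less_eq mult.commute)
    finally have v: "dist v v0 < \<eta>"
      by (simp add: dist_norm)
    have "chronological M (chart_inv c x) (chart_inv c (x + l *\<^sub>R v))"
    proof (rule chronological_line[OF l(1)])
      fix \<tau> assume \<tau>: "\<tau> \<in> {0..l}"
      have "(1 - \<tau> / l) *\<^sub>R x + (\<tau> / l) *\<^sub>R y \<in> ball x0 \<eta>"
        using xy \<tau> l(1) by (intro convexD[OF convex_ball]) (auto simp: dist_commute)
      moreover have "(1 - \<tau> / l) *\<^sub>R x + (\<tau> / l) *\<^sub>R y = x + \<tau> *\<^sub>R v"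
        by (simp add: v_def algebra_simps)
      ultimately have "dist (x + \<tau> *\<^sub>R v) x0 < \<eta>"
        by (simp add: dist_commute)
      then show "x + \<tau> *\<^sub>R v \<in> S \<and> future_timelike M c (chart_inv c (x + \<tau> *\<^sub>R v)) v"
        using \<eta>(2) v by blast
    qed
    then show ?thesis
      using l(1) by (simp add: v_def)
  qed
  moreover have "ball x0 \<eta> \<subseteq> S"
    using \<eta>(2)[of _ v0] \<eta>(1) by (auto simp: dist_commute)
  ultimately show thesis
    using that \<eta>(1) by blast
qed

section \<open>Causal curves tilted into timelike ones\<close>

text \<open>
  The metric is Lipschitz along the direction \<open>z\<close>, uniformly for base points near \<open>x\<^sub>0\<close> and vectors near \<open>u\<^sub>0\<close>, by
  the mean value theorem: the directional derivative is continuous in both and hence locally bounded.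
\<close>

lemma G_directional_bound:
  assumes x0: "x0 \<in> S"
  obtains L \<eta> where "L > 0" "\<eta> > 0"
    "\<And>x u r. 0 \<le> r \<Longrightarrow> (\<And>\<tau>. \<tau> \<in> {0..r} \<Longrightarrow> dist (x + \<tau> *\<^sub>R z) x0 < \<eta>) \<Longrightarrow> dist u u0 < \<eta> \<Longrightarrow>
      G (x + r *\<^sub>R z) u u \<le> G x u u + r * L"
proof -
  \<comment> \<open>\<open>H x u\<close> is the derivative of \<open>G x u u\<close> along \<open>z\<close> at fixed \<open>u\<close>. The polynomial \<open>Q\<close> equals \<open>G x u u\<close> on \<open>S\<close>.\<close>
  define D where "D i j x = frechet_derivative (\<lambda>x. G x i j) (at x) z" for i j x
  define H where "H x u = (\<Sum>i\<in>Basis. \<Sum>j\<in>Basis. (u \<bullet> i) * (u \<bullet> j) * D i j x)" for x u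
  define Q where "Q x u = (\<Sum>i\<in>Basis. \<Sum>j\<in>Basis. (u \<bullet> i) * (u \<bullet> j) * G x i j)" for x u
  define L where "L = \<bar>H x0 u0\<bar> + 1"
  let ?F = "nhds x0 \<times>\<^sub>F nhds u0"
  have cont_D: "continuous_on S (D i j)" for i j
    unfolding D_def by (rule G_derivative_continuous)
  have Q: "Q x u = G x u u" if "x \<in> S" for x u
    unfolding Q_def by (rule bilinear_Basis_expansion[OF G_bilinear[OF that], symmetric])
  have "((\<lambda>p. H (fst p) (snd p)) \<longlongrightarrow> H x0 u0) ?F"
    unfolding H_def
    by (intro tendsto_intros tendsto_on_S[OF cont_D x0 filterlim_fst] filterlim_snd)
  then have "\<forall>\<^sub>F p in ?F. H (fst p) (snd p) < L"
    by (rule order_tendstoD(2)) (simp add: L_def)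
  moreover have "\<forall>\<^sub>F p in ?F. fst p \<in> S"
    using filterlim_fst open_S x0 by (rule topological_tendstoD)
  ultimately have "\<forall>\<^sub>F p in ?F. fst p \<in> S \<and> H (fst p) (snd p) < L"
    by eventually_elim simp
  then obtain \<eta> where \<eta>: "\<eta> > 0" "\<And>x u. dist x x0 < \<eta> \<Longrightarrow> dist u u0 < \<eta> \<Longrightarrow> x \<in> S \<and> H x u < L"
    by (rule eventually_nhds_prod_dist) auto
  have "G (x + r *\<^sub>R z) u u \<le> G x u u + r * L"
    if r: "0 \<le> r" and path: "\<And>\<tau>. \<tau> \<in> {0..r} \<Longrightarrow> dist (x + \<tau> *\<^sub>R z) x0 < \<eta>" and u: "dist u u0 < \<eta>" for x u r
  proof (cases "r = 0")
    case False
    have in_S: "x + \<tau> *\<^sub>R z \<in> S" and H_less: "H (x + \<tau> *\<^sub>R z) u < L" if "\<tau> \<in> {0..r}" for \<tau>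
      using \<eta>(2)[OF path[OF that] u] by auto
    have "((\<lambda>\<tau>. Q (x + \<tau> *\<^sub>R z) u) has_real_derivative H (x + \<tau> *\<^sub>R z) u) (at \<tau>)"
      if "\<tau> \<in> {0..r}" for \<tau>
    proof -
      have "((\<lambda>\<tau>. G (x + \<tau> *\<^sub>R z) i j) has_real_derivative D i j (x + \<tau> *\<^sub>R z)) (at \<tau>)" for i j
      proof -
        have "((\<lambda>\<tau>. x + \<tau> *\<^sub>R z) has_vector_derivative z) (at \<tau>)"
          by (auto intro!: derivative_eq_intros)
        moreover have "((\<lambda>x. G x i j) has_derivative frechet_derivative (\<lambda>x. G x i j) (at (x + \<tau> *\<^sub>R z)))
            (at (x + \<tau> *\<^sub>R z) within range (\<lambda>\<tau>. x + \<tau> *\<^sub>R z))"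
          using G_differentiable[OF in_S[OF that]] frechet_derivative_works has_derivative_at_withinI
          by blast
        ultimately show ?thesis
          using vector_derivative_diff_chain_within[of "\<lambda>\<tau>. x + \<tau> *\<^sub>R z" z \<tau> UNIV "\<lambda>x. G x i j"]
          by (simp add: o_def D_def has_real_derivative_iff_has_vector_derivative)
      qed
      then show ?thesis
        unfolding Q_def H_def by (intro DERIV_sum DERIV_cmult)
    qed
    then obtain \<xi> where \<xi>: "0 < \<xi>" "\<xi> < r"
      "Q (x + r *\<^sub>R z) u - Q (x + 0 *\<^sub>R z) u = (r - 0) * H (x + \<xi> *\<^sub>R z) u"
      using MVT2[of 0 r "\<lambda>\<tau>. Q (x + \<tau> *\<^sub>R z) u" "\<lambda>\<tau>. H (x + \<tau> *\<^sub>R z) u"] r False by auto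
    have "r * H (x + \<xi> *\<^sub>R z) u \<le> r * L"
      using H_less[of \<xi>] \<xi>(1,2) r by (intro mult_left_mono) auto
    then show ?thesis
      using \<xi>(3) Q[of "x + r *\<^sub>R z"] Q[of x] in_S[of 0] in_S[of r] r by simp
  qed simp
  moreover have "L > 0"
    by (simp add: L_def add_nonneg_pos)
  ultimately show thesis
    using that \<eta>(1) by blast
qed

text \<open>
  The curve is tilted to \<open>\<sigma>(\<tau>) = \<gamma>(\<tau>) - \<epsilon> (t - \<tau>) w\<close>, with velocity \<open>V + \<epsilon> w\<close>. Since \<open>g(V, w) < - k\<close> near \<open>t\<^sub>0\<close>, the tilt
  contributes less than \<open>- 2 \<epsilon> k\<close> to the square of the velocity, while the displacement by at most
  \<open>\<epsilon> (t - s) w\<close> raises \<open>g(V, V) \<le> 0\<close> by at most \<open>\<epsilon> (t - s) L\<close>, which is below \<open>\<epsilon> k\<close> once \<open>t - s < k / L\<close>. So \<open>\<sigma>\<close> is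
  timelike for every small \<open>\<epsilon>\<close>. Its start tends to \<open>\<gamma>(s)\<close> as \<open>\<epsilon>\<close> tends to 0 and thus lies in the open future of \<open>y\<close>.
\<close>

lemma local_push_up:
  assumes \<gamma>: "segment_with (future_causal M) M \<gamma> a b" and t0: "t0 \<in> {a..b}" "\<gamma> t0 \<in> chart_dom c"
    and open_future: "open {q. chronological M y q}"
  obtains \<delta> where "\<delta> > 0" "\<And>s t. {s..t} \<subseteq> {a..b} \<Longrightarrow> t0 \<in> {s..t} \<Longrightarrow> s < t \<Longrightarrow> t - s < \<delta> \<Longrightarrow>
    chronological M y (\<gamma> s) \<Longrightarrow> chronological M y (\<gamma> t)"
proof -
  define f where "f = snd c \<circ> \<gamma>"
  define V where "V = velocity c \<gamma> a b"
  define I where "I = {a..b} \<inter> \<gamma> -` chart_dom c"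
  define x0 where "x0 = f t0"
  define w where "w = W x0"
  \<comment> \<open>Half of \<open>- g(V, w)\<close> at \<open>t\<^sub>0\<close>, so that \<open>g(V, w) < - k\<close> persists nearby.\<close>
  define k where "k = - G x0 (V t0) w / 2"
  let ?F = "nhds x0 \<times>\<^sub>F nhds (V t0)"
  have t0I: "t0 \<in> I"
    using t0 by (simp add: I_def)
  have f_S: "f t \<in> S" if "t \<in> I" for t
    using that coord_in by (simp add: f_def I_def)
  have x0: "x0 \<in> S"
    using f_S[OF t0I] by (simp add: x0_def)
  have vel: "(f has_vector_derivative V t) (at t within {a..b})" "G (f t) (V t) (V t) \<le> 0"
    "G (f t) (V t) (W (f t)) < 0" if "t \<in> I" for t
    using segment_with_velocity(2,3)[OF \<gamma> chart, of t] that
    by (auto simp: f_def V_def I_def future_causal_def metric_eq time_field_eq)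
  have "k > 0"
    using vel(3)[OF t0I] by (simp add: k_def w_def x0_def)
  have w_neg: "G x0 w w < 0"
    using W_timelike[OF x0] by (simp add: w_def)
  have Vw: "G x0 (V t0) w < - k" "G x0 w (V t0) < - k"
    using \<open>k > 0\<close> lorentzian_form_sym[OF G_lorentzian[OF x0], of w "V t0"] by (auto simp: k_def)
  have VW: "G x0 (V t0) (W x0) < 0" "G x0 w (W x0) < 0"
    using vel(3)[OF t0I] w_neg by (simp_all add: x0_def w_def)
  have "\<forall>\<^sub>F p in ?F. fst p \<in> S"
    using filterlim_fst open_S x0 by (rule topological_tendstoD)
  moreover have "\<forall>\<^sub>F p in ?F. G (fst p) (snd p) w < - k"
    by (rule order_tendstoD(2)[OF G_tendsto[OF x0 filterlim_fst filterlim_snd tendsto_const] Vw(1)])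
  moreover have "\<forall>\<^sub>F p in ?F. G (fst p) w (snd p) < - k"
    by (rule order_tendstoD(2)[OF G_tendsto[OF x0 filterlim_fst tendsto_const filterlim_snd] Vw(2)])
  moreover have "\<forall>\<^sub>F p in ?F. G (fst p) w w < 0"
    by (rule order_tendstoD(2)[OF G_tendsto[OF x0 filterlim_fst tendsto_const tendsto_const] w_neg])
  moreover have "\<forall>\<^sub>F p in ?F. G (fst p) (snd p) (W (fst p)) < 0"
    by (rule order_tendstoD(2)[OF G_tendsto[OF x0 filterlim_fst filterlim_snd W_tendsto[OF x0 filterlim_fst]] VW(1)])
  moreover have "\<forall>\<^sub>F p in ?F. G (fst p) w (W (fst p)) < 0"
    by (rule order_tendstoD(2)[OF G_tendsto[OF x0 filterlim_fst tendsto_const W_tendsto[OF x0 filterlim_fst]] VW(2)])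
  ultimately have "\<forall>\<^sub>F p in ?F. fst p \<in> S \<and> G (fst p) (snd p) w < - k \<and> G (fst p) w (snd p) < - k \<and>
      G (fst p) w w < 0 \<and> G (fst p) (snd p) (W (fst p)) < 0 \<and> G (fst p) w (W (fst p)) < 0"
    by eventually_elim simp
  then obtain \<eta>1 where \<eta>1: "\<eta>1 > 0" "\<And>x u. dist x x0 < \<eta>1 \<Longrightarrow> dist u (V t0) < \<eta>1 \<Longrightarrow>
      x \<in> S \<and> G x u w < - k \<and> G x w u < - k \<and> G x w w < 0 \<and> G x u (W x) < 0 \<and> G x w (W x) < 0"
    by (rule eventually_nhds_prod_dist) auto
  obtain L \<eta>2 where L: "L > 0" "\<eta>2 > 0" "\<And>x u r. 0 \<le> r \<Longrightarrow>
      (\<And>\<tau>. \<tau> \<in> {0..r} \<Longrightarrow> dist (x + \<tau> *\<^sub>R (- w)) x0 < \<eta>2) \<Longrightarrow> dist u (V t0) < \<eta>2 \<Longrightarrow>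
      G (x + r *\<^sub>R (- w)) u u \<le> G x u u + r * L"
    using G_directional_bound[OF x0] by metis
  define \<eta> where "\<eta> = min \<eta>1 \<eta>2"
  have \<eta>: "\<eta> > 0" "\<eta> \<le> \<eta>1" "\<eta> \<le> \<eta>2"
    using \<eta>1(1) L(2) by (auto simp: \<eta>_def)
  obtain \<delta>1 where \<delta>1: "\<delta>1 > 0" "\<And>t. t \<in> {a..b} \<Longrightarrow> \<bar>t - t0\<bar> < \<delta>1 \<Longrightarrow> \<gamma> t \<in> chart_dom c"
    using continuous_on_nearby[OF segment_with_continuous[OF \<gamma>] t0(1) open_dom t0(2)] by metis
  have cont_V: "continuous_on I V"
    unfolding I_def V_def by (rule segment_with_velocity(1)[OF \<gamma> chart])
  have cont_f: "continuous_on I f"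
    unfolding f_def I_def
    by (rule continuous_on_compose[OF continuous_on_subset[OF segment_with_continuous[OF \<gamma>]]
        continuous_on_subset[OF continuous_coord]]) auto
  obtain \<delta>2 where \<delta>2: "\<delta>2 > 0" "\<And>t. t \<in> I \<Longrightarrow> \<bar>t - t0\<bar> < \<delta>2 \<Longrightarrow> V t \<in> ball (V t0) \<eta>"
    using continuous_on_nearby[OF cont_V t0I open_ball, of "V t0" \<eta>] \<eta>(1) by auto
  obtain \<delta>3 where \<delta>3: "\<delta>3 > 0" "\<And>t. t \<in> I \<Longrightarrow> \<bar>t - t0\<bar> < \<delta>3 \<Longrightarrow> f t \<in> ball x0 (\<eta> / 2)"
    using continuous_on_nearby[OF cont_f t0I open_ball, of x0 "\<eta> / 2"] \<eta>(1) by (auto simp: x0_def)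
  define \<delta> where "\<delta> = min (min \<delta>1 \<delta>2) (min \<delta>3 (k / L))"
  have "\<delta> > 0"
    using \<delta>1 \<delta>2 \<delta>3 \<open>k > 0\<close> \<open>L > 0\<close> by (simp add: \<delta>_def)
  moreover have "chronological M y (\<gamma> t)"
    if st: "{s..t} \<subseteq> {a..b}" "t0 \<in> {s..t}" "s < t" "t - s < \<delta>" and y: "chronological M y (\<gamma> s)" for s t
  proof -
    have near: "\<tau> \<in> I" "dist (V \<tau>) (V t0) < \<eta>" "dist (f \<tau>) x0 < \<eta> / 2" if "\<tau> \<in> {s..t}" for \<tau>
    proof -
      have "\<tau> \<in> {a..b}"
        using that st(1) by blast
      have "\<bar>\<tau> - t0\<bar> < \<delta>"
        using that st(2,4) by auto
      then have "\<bar>\<tau> - t0\<bar> < \<delta>1" "\<bar>\<tau> - t0\<bar> < \<delta>2" "\<bar>\<tau> - t0\<bar> < \<delta>3"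
        by (auto simp: \<delta>_def)
      then show "\<tau> \<in> I" "dist (V \<tau>) (V t0) < \<eta>" "dist (f \<tau>) x0 < \<eta> / 2"
        using \<delta>1(2) \<delta>2(2) \<delta>3(2) \<open>\<tau> \<in> {a..b}\<close> by (auto simp: I_def dist_commute)
    qed
    have "(t - s) * L < k"
      using st(4) \<open>L > 0\<close> by (simp add: \<delta>_def pos_less_divide_eq)
    define T where "T = S \<inter> chart_inv c -` {q. chronological M y q}"
    have "open T"
      unfolding T_def by (rule continuous_open_preimage[OF continuous_inv open_S open_future])
    have inv_f: "chart_inv c (f \<tau>) = \<gamma> \<tau>" if "\<tau> \<in> I" for \<tau>
      using that by (simp add: f_def I_def)
    have "f s \<in> T"
      using near(1)[of s] f_S[of s] inv_f[of s] st(3) y by (simp add: T_def)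
    then obtain \<rho> where \<rho>: "\<rho> > 0" "ball (f s) \<rho> \<subseteq> T"
      using \<open>open T\<close> open_contains_ball by blast
    \<comment> \<open>The bound \<open>\<rho>\<close> puts the start of the tilted curve into the future of \<open>y\<close>; the bound \<open>\<eta> / 2\<close> keeps the whole curve where the estimates hold.\<close>
    obtain \<epsilon> where \<epsilon>: "\<epsilon> > 0" "\<epsilon> * ((t - s) * norm w) < min \<rho> (\<eta> / 2)"
      using small_scale[of 1 "min \<rho> (\<eta> / 2)" "(t - s) * norm w"] \<rho>(1) \<eta>(1) st(3) by auto
    define \<sigma> where "\<sigma> \<tau> = f \<tau> - (\<epsilon> * (t - \<tau>)) *\<^sub>R w" for \<tau>
    have shift: "r * norm w < \<eta> / 2" "r * norm w < \<rho>" if "r \<le> \<epsilon> * (t - s)" for r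
    proof -
      have "r * norm w \<le> \<epsilon> * (t - s) * norm w"
        using that by (rule mult_right_mono) simp
      then show "r * norm w < \<eta> / 2" "r * norm w < \<rho>"
        using \<epsilon>(2) by (simp_all add: mult.assoc)
    qed
    have shifted: "dist (f \<tau> - r *\<^sub>R w) x0 < \<eta>" if "\<tau> \<in> {s..t}" "0 \<le> r" "r \<le> \<epsilon> * (t - s)" for \<tau> r
    proof -
      have "dist (f \<tau> - r *\<^sub>R w) x0 \<le> dist (f \<tau> - r *\<^sub>R w) (f \<tau>) + dist (f \<tau>) x0"
        by (rule dist_triangle)
      also have "dist (f \<tau> - r *\<^sub>R w) (f \<tau>) = r * norm w"
        using that(2) by (simp add: dist_norm)
      finally show ?thesis
        using shift(1)[OF that(3)] near(3)[OF that(1)] by simp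
    qed
    have "timelike_segment M (chart_inv c \<circ> \<sigma>) s t"
    proof (rule timelike_segment_chart[OF st(3)])
      fix \<tau> assume \<tau>: "\<tau> \<in> {s..t}"
      define r where "r = \<epsilon> * (t - \<tau>)"
      have r: "0 \<le> r" "r \<le> \<epsilon> * (t - s)"
        using \<epsilon>(1) \<tau> by (auto simp: r_def)
      have \<sigma>_eq: "\<sigma> \<tau> = f \<tau> - r *\<^sub>R w"
        by (simp add: \<sigma>_def r_def)
      have x: "dist (\<sigma> \<tau>) x0 < \<eta>1"
        unfolding \<sigma>_eq using shifted[OF \<tau> r] \<eta>(2) by simp
      have u: "dist (V \<tau>) (V t0) < \<eta>1" "dist (V \<tau>) (V t0) < \<eta>2"
        using near(2)[OF \<tau>] \<eta>(2,3) by auto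
      note bounds = \<eta>1(2)[OF x u(1)]
      then show "\<sigma> \<tau> \<in> S"
        by blast
      then have bil: "bilinear (G (\<sigma> \<tau>))"
        by (rule G_bilinear)
      show "(\<sigma> has_vector_derivative V \<tau> + \<epsilon> *\<^sub>R w) (at \<tau> within {s..t})"
      proof -
        have "(f has_vector_derivative V \<tau>) (at \<tau> within {s..t})"
          using vel(1)[OF near(1)[OF \<tau>]] st(1) by (rule has_vector_derivative_within_subset)
        then show ?thesis
          unfolding \<sigma>_def[abs_def] by (auto intro!: derivative_eq_intros)
      qed
      have "G (\<sigma> \<tau>) (V \<tau>) (V \<tau>) \<le> G (f \<tau>) (V \<tau>) (V \<tau>) + r * L"
        using L(3)[OF r(1), of "f \<tau>" "V \<tau>"] shifted[OF \<tau>] r u(2) \<eta>(3)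
        unfolding \<sigma>_eq by force
      also have "\<dots> \<le> r * L"
        using vel(2)[OF near(1)[OF \<tau>]] by simp
      also have "\<dots> \<le> \<epsilon> * ((t - s) * L)"
        using r(2) \<open>L > 0\<close> by (simp add: mult.assoc[symmetric])
      also have "\<dots> < \<epsilon> * k"
        using \<open>(t - s) * L < k\<close> \<epsilon>(1) by (rule mult_strict_left_mono)
      finally have VV: "G (\<sigma> \<tau>) (V \<tau>) (V \<tau>) < \<epsilon> * k" .
      have "\<epsilon> * G (\<sigma> \<tau>) (V \<tau>) w < - \<epsilon> * k" "\<epsilon> * G (\<sigma> \<tau>) w (V \<tau>) < - \<epsilon> * k"
        using bounds mult_strict_left_mono[OF _ \<epsilon>(1), of _ "- k"] by auto
      moreover have "\<epsilon> * (\<epsilon> * G (\<sigma> \<tau>) w w) < 0" "\<epsilon> * G (\<sigma> \<tau>) w (W (\<sigma> \<tau>)) < 0"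
        using bounds \<epsilon>(1) by (simp_all add: mult_pos_neg)
      moreover have "\<epsilon> * k > 0"
        using \<epsilon>(1) \<open>k > 0\<close> by simp
      moreover have "G (\<sigma> \<tau>) (V \<tau> + \<epsilon> *\<^sub>R w) (V \<tau> + \<epsilon> *\<^sub>R w) =
          G (\<sigma> \<tau>) (V \<tau>) (V \<tau>) + \<epsilon> * G (\<sigma> \<tau>) (V \<tau>) w + \<epsilon> * G (\<sigma> \<tau>) w (V \<tau>) + \<epsilon> * (\<epsilon> * G (\<sigma> \<tau>) w w)"
        by (simp add: bilinear_ladd[OF bil] bilinear_radd[OF bil] bilinear_lmul[OF bil]
            bilinear_rmul[OF bil] distrib_left)
      moreover have "G (\<sigma> \<tau>) (V \<tau> + \<epsilon> *\<^sub>R w) (W (\<sigma> \<tau>)) =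
          G (\<sigma> \<tau>) (V \<tau>) (W (\<sigma> \<tau>)) + \<epsilon> * G (\<sigma> \<tau>) w (W (\<sigma> \<tau>))"
        by (simp add: bilinear_ladd[OF bil] bilinear_lmul[OF bil])
      ultimately show "future_timelike M c (chart_inv c (\<sigma> \<tau>)) (V \<tau> + \<epsilon> *\<^sub>R w)"
        unfolding future_timelike_chart[OF \<open>\<sigma> \<tau> \<in> S\<close>] using VV bounds by linarith
    next
      show "continuous_on {s..t} (\<lambda>\<tau>. V \<tau> + \<epsilon> *\<^sub>R w)"
        using near(1) by (intro continuous_intros continuous_on_subset[OF cont_V]) auto
    qed
    then have "chronological M (chart_inv c (\<sigma> s)) (chart_inv c (\<sigma> t))"
      using chronologicalI by fastforce
    moreover have "chart_inv c (\<sigma> t) = \<gamma> t"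
      using inv_f near(1)[of t] st(3) by (simp add: \<sigma>_def)
    moreover have "\<sigma> s \<in> ball (f s) \<rho>"
      using shift(2)[of "\<epsilon> * (t - s)"] \<epsilon>(1) st(3) by (simp add: \<sigma>_def dist_norm)
    then have "chronological M y (chart_inv c (\<sigma> s))"
      using \<rho>(2) by (auto simp: T_def)
    ultimately show ?thesis
      using chronological_trans by metis
  qed
  ultimately show thesis
    by (rule that)
qed

end

section \<open>Past density, open futures and push-up\<close>

lemma chart_at:
  assumes "smooth_spacetime M"
  obtains c where "c \<in> atlas M" "q \<in> chart_dom c" "coordinate_chart M c"
proof -
  have "(\<Union>c\<in>atlas M. chart_dom c) = UNIV"
    using assms by (simp add: smooth_spacetime_def smooth_atlas_def)
  then obtain c where "c \<in> atlas M" "q \<in> chart_dom c"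
    by blast
  with assms show thesis
    using that coordinate_chart.intro by blast
qed

text \<open>
  Follow the constant coordinate vector given by the time field at \<open>q\<close> a short way backwards.
\<close>

lemma past_accumulates:
  assumes "smooth_spacetime M" "open U" "q \<in> U"
  shows "\<exists>p\<in>U. chronological M p q"
proof -
  obtain c where c: "q \<in> chart_dom c" "coordinate_chart M c"
    using chart_at[OF assms(1)] .
  interpret coordinate_chart M c by fact
  define x0 where "x0 = snd c q"
  define w where "w = W x0"
  have x0: "x0 \<in> S" "chart_inv c x0 = q"
    using c(1) coord_in by (simp_all add: x0_def)
  have "future_timelike M c (chart_inv c x0) w"
    using W_timelike[OF x0(1)] by (simp add: future_timelike_chart[OF x0(1)] w_def)
  then obtain \<eta> where \<eta>: "\<eta> > 0" "ball x0 \<eta> \<subseteq> S"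
    "\<And>x y l. dist x x0 < \<eta> \<Longrightarrow> dist y x0 < \<eta> \<Longrightarrow> l > 0 \<Longrightarrow>
      norm (y - x - l *\<^sub>R w) < l * \<eta> \<Longrightarrow> chronological M (chart_inv c x) (chart_inv c y)"
    using chronological_near_timelike_vector[OF x0(1)] by metis
  have "open (S \<inter> chart_inv c -` U)"
    by (rule continuous_open_preimage[OF continuous_inv open_S assms(2)])
  moreover have "x0 \<in> S \<inter> chart_inv c -` U"
    using x0 assms(3) by simp
  ultimately obtain \<rho> where \<rho>: "\<rho> > 0" "ball x0 \<rho> \<subseteq> S \<inter> chart_inv c -` U"
    using open_contains_ball by blast
  obtain l where l: "l > 0" "l * norm w < min \<eta> \<rho>"
    using small_scale[of 1 "min \<eta> \<rho>" "norm w"] \<eta>(1) \<rho>(1) by auto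
  have dist: "dist (x0 - l *\<^sub>R w) x0 = l * norm w"
    using l(1) by (simp add: dist_norm)
  have "chronological M (chart_inv c (x0 - l *\<^sub>R w)) (chart_inv c x0)"
    using dist l \<eta>(1) by (intro \<eta>(3)[of _ _ l]) simp_all
  moreover have "x0 - l *\<^sub>R w \<in> ball x0 \<rho>"
    using dist l by (simp add: dist_commute)
  then have "chart_inv c (x0 - l *\<^sub>R w) \<in> U"
    using \<rho>(2) by blast
  ultimately show ?thesis
    using x0(2) by auto
qed

lemma piecewise_last:
  assumes "piecewise P \<gamma> a b"
  shows "\<exists>a'. P \<gamma> a' b \<and> (a' = a \<or> piecewise P \<gamma> a a')"
proof -
  obtain n s where s: "0 < n" "s 0 = a" "s n = b" "\<forall>i<n. s i < s (Suc i) \<and> P \<gamma> (s i) (s (Suc i))"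
    using assms unfolding piecewise_def by blast
  obtain m where m: "n = Suc m"
    using s(1) gr0_implies_Suc by blast
  have "P \<gamma> (s m) b"
    using s(3,4) m by auto
  moreover have "s m = a \<or> piecewise P \<gamma> a (s m)"
  proof (cases "m = 0")
    case False
    then have "piecewise P \<gamma> a (s m)"
      unfolding piecewise_def using s m by (intro exI[of _ m] exI[of _ s]) auto
    then show ?thesis ..
  qed (use s(2) in simp)
  ultimately show ?thesis
    by blast
qed

lemma chronological_last_segment:
  assumes "chronological M y q"
  obtains \<gamma> a b where "segment_with (future_timelike M) M \<gamma> a b" "\<gamma> b = q"
    "\<And>t. a < t \<Longrightarrow> t \<le> b \<Longrightarrow> chronological M y (\<gamma> t)"
proof -
  obtain \<gamma> a b where \<gamma>: "piecewise (segment_with (future_timelike M) M) \<gamma> a b" "\<gamma> a = y" "\<gamma> b = q"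
    using assms unfolding chronological_def timelike_curve_eq by blast
  obtain a' where a': "segment_with (future_timelike M) M \<gamma> a' b"
    "a' = a \<or> piecewise (segment_with (future_timelike M) M) \<gamma> a a'"
    using piecewise_last[OF \<gamma>(1)] by blast
  have start: "a' = a \<or> chronological M y (\<gamma> a')"
    using a'(2) \<gamma>(2) unfolding chronological_def timelike_curve_eq by blast
  have "chronological M y (\<gamma> t)" if t: "a' < t" "t \<le> b" for t
  proof -
    have "segment_with (future_timelike M) M \<gamma> a' t"
      by (rule segment_with_transfer[OF a'(1) t(1), where k = 0]) (use t in auto)
    then have "chronological M (\<gamma> a') (\<gamma> t)"
      by (intro chronologicalI) (simp add: timelike_segment_eq)
    then show ?thesis
      using start \<gamma>(2) chronological_trans by blast
  qed
  with a'(1) \<gamma>(3) show thesis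
    by (rule that)
qed

text \<open>
  Let \<open>v\<close> be the final velocity of a timelike curve from \<open>y\<close> to \<open>q\<close>. For small \<open>l\<close> the mean velocity from
  \<open>\<gamma>(b - l)\<close> to \<open>q\<close> is close to \<open>v\<close>, and it stays so if \<open>q\<close> is moved by a small fraction of \<open>l\<close>. A straight
  timelike segment then leads from \<open>\<gamma>(b - l)\<close> to the moved point.
\<close>

lemma open_chronological_future:
  assumes M: "smooth_spacetime M"
  shows "open {q. chronological M y q}"
proof (subst open_subopen, intro ballI)
  fix q assume "q \<in> {q. chronological M y q}"
  then obtain \<gamma> a b where \<gamma>: "segment_with (future_timelike M) M \<gamma> a b" "\<gamma> b = q"
    and y: "\<And>t. a < t \<Longrightarrow> t \<le> b \<Longrightarrow> chronological M y (\<gamma> t)"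
    using chronological_last_segment[of M y q] by auto
  obtain c where c: "c \<in> atlas M" "q \<in> chart_dom c" "coordinate_chart M c"
    using chart_at[OF M] .
  interpret coordinate_chart M c by fact
  have "a < b"
    by (rule segment_with_less[OF \<gamma>(1)])
  then have b: "b \<in> {a..b}" "\<gamma> b \<in> chart_dom c"
    using c(2) \<gamma>(2) by auto
  define f where "f = snd c \<circ> \<gamma>"
  define v where "v = velocity c \<gamma> a b b"
  have x0: "f b \<in> S" "chart_inv c (f b) = q"
    using c(2) \<gamma>(2) coord_in by (simp_all add: f_def)
  have der: "(f has_derivative (\<lambda>h. h *\<^sub>R v)) (at b within {a..b})"
    using segment_with_velocity(2)[OF \<gamma>(1) c(1) b]
    by (simp add: f_def v_def has_vector_derivative_def)
  have "future_timelike M c (chart_inv c (f b)) v"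
    using segment_with_velocity(3)[OF \<gamma>(1) c(1) b] \<gamma>(2) x0(2) by (simp add: v_def)
  then obtain \<eta> where \<eta>: "\<eta> > 0" "ball (f b) \<eta> \<subseteq> S"
    "\<And>x y l. dist x (f b) < \<eta> \<Longrightarrow> dist y (f b) < \<eta> \<Longrightarrow> l > 0 \<Longrightarrow>
      norm (y - x - l *\<^sub>R v) < l * \<eta> \<Longrightarrow> chronological M (chart_inv c x) (chart_inv c y)"
    using chronological_near_timelike_vector[OF x0(1)] by metis
  \<comment> \<open>Two errors enter below, that of the difference quotient and that of the endpoint; two thirds of \<open>\<eta>\<close> leave the inequality strict.\<close>
  have "0 < \<eta> / 3"
    using \<eta>(1) by simp
  then obtain d where d: "d > 0" "\<And>t. t \<in> {a..b} \<Longrightarrow> norm (t - b) < d \<Longrightarrow>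
      norm (f t - f b - (t - b) *\<^sub>R v) \<le> \<eta> / 3 * norm (t - b)"
    using der unfolding has_derivative_within_alt by blast
  obtain d' where d': "d' > 0" "\<And>t. t \<in> {a..b} \<Longrightarrow> \<bar>t - b\<bar> < d' \<Longrightarrow> \<gamma> t \<in> chart_dom c"
    using continuous_on_nearby[OF segment_with_continuous[OF \<gamma>(1)] b(1) open_dom b(2)] by metis
  obtain l where l: "l > 0" "l < min (min d d') (b - a)" "l * (norm v + \<eta>) < \<eta>"
    using small_scale[of "min (min d d') (b - a)" \<eta> "norm v + \<eta>"] d(1) d'(1) \<open>a < b\<close> \<eta>(1) by auto
  define x where "x = f (b - l)"
  have "b - l \<in> {a..b}"
    using l by simp
  then have dom: "\<gamma> (b - l) \<in> chart_dom c" and "norm (x - f b - (- l) *\<^sub>R v) \<le> \<eta> / 3 * l"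
    using d(2)[of "b - l"] d'(2)[of "b - l"] l by (auto simp: x_def)
  then have err: "norm (x - f b + l *\<^sub>R v) \<le> \<eta> / 3 * l"
    by simp
  have "norm (x - f b) \<le> norm (x - f b + l *\<^sub>R v) + norm (l *\<^sub>R v)"
    using norm_triangle_ineq4[of "x - f b + l *\<^sub>R v" "l *\<^sub>R v"] by simp
  also have "\<dots> \<le> \<eta> / 3 * l + l * norm v"
    using err l(1) by simp
  also have "\<dots> \<le> l * (norm v + \<eta>)"
    using l(1) \<eta>(1) by (simp add: algebra_simps)
  finally have x_near: "dist x (f b) < \<eta>"
    using l(3) by (simp add: dist_norm)
  have y_x: "chronological M y (chart_inv c x)"
    using y[of "b - l"] l dom by (simp add: x_def f_def)
  define T where "T = chart_dom c \<inter> snd c -` ball (f b) (min \<eta> (\<eta> / 3 * l))"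
  have "open T"
    unfolding T_def by (rule continuous_open_preimage[OF continuous_coord open_dom open_ball])
  moreover have "q \<in> T"
    using c(2) \<gamma>(2) \<eta>(1) l(1) by (simp add: T_def f_def)
  moreover have "T \<subseteq> {q. chronological M y q}"
  proof
    fix q' assume "q' \<in> T"
    then have q': "q' \<in> chart_dom c" "dist (snd c q') (f b) < \<eta>" "norm (snd c q' - f b) < \<eta> / 3 * l"
      by (auto simp: T_def dist_commute dist_norm[symmetric])
    have "snd c q' - x - l *\<^sub>R v = (snd c q' - f b) - (x - f b + l *\<^sub>R v)"
      by simp
    then have "norm (snd c q' - x - l *\<^sub>R v) \<le> norm (snd c q' - f b) + norm (x - f b + l *\<^sub>R v)"
      using norm_triangle_ineq4 by metis
    also have "\<dots> < \<eta> / 3 * l + \<eta> / 3 * l"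
      using q'(3) err by (rule add_less_le_mono)
    also have "\<dots> < l * \<eta>"
      using l(1) \<eta>(1) by simp
    finally have "chronological M (chart_inv c x) (chart_inv c (snd c q'))"
      by (intro \<eta>(3)[OF x_near q'(2) l(1)])
    then show "q' \<in> {q. chronological M y q}"
      using y_x q'(1) chronological_trans by auto
  qed
  ultimately show "\<exists>T. open T \<and> q \<in> T \<and> T \<subseteq> {q. chronological M y q}"
    by blast
qed

text \<open>
  The implication from \<open>y \<ll> \<gamma>(s)\<close> to \<open>y \<ll> \<gamma>(t)\<close> composes over adjacent intervals, and by
  \<open>local_push_up\<close> it holds on every short interval around a given parameter; so bisection applies.
\<close>

lemma push_up_segment:
  assumes M: "smooth_spacetime M" and \<gamma>: "segment_with (future_causal M) M \<gamma> a b"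
    and y: "chronological M y (\<gamma> a)"
  shows "chronological M y (\<gamma> b)"
proof -
  \<comment> \<open>\<open>J\<close> is the fixed interval of definition, on which the bisected parameters lie.\<close>
  define J where "J = {a..b}"
  let ?P = "\<lambda>s t. s \<le> t \<and> {s..t} \<subseteq> J \<longrightarrow> chronological M y (\<gamma> s) \<longrightarrow> chronological M y (\<gamma> t)"
  have "a \<le> b"
    using segment_with_less[OF \<gamma>] by simp
  then have "?P a b"
  proof (rule Bolzano)
    fix r s t :: real
    assume "?P r s" "?P s t" "r \<le> s" "s \<le> t"
    moreover from this have "{r..s} \<subseteq> {r..t}" "{s..t} \<subseteq> {r..t}"
      by auto
    ultimately show "?P r t"
      by (meson subset_trans)
  next
    fix t0 assume "a \<le> t0" "t0 \<le> b"
    then have "t0 \<in> {a..b}"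
      by simp
    obtain c where c: "\<gamma> t0 \<in> chart_dom c" "coordinate_chart M c"
      using chart_at[OF M] .
    interpret coordinate_chart M c by fact
    obtain \<delta> where \<delta>: "\<delta> > 0" "\<And>s t. {s..t} \<subseteq> {a..b} \<Longrightarrow> t0 \<in> {s..t} \<Longrightarrow> s < t \<Longrightarrow> t - s < \<delta> \<Longrightarrow>
        chronological M y (\<gamma> s) \<Longrightarrow> chronological M y (\<gamma> t)"
      using local_push_up[OF \<gamma> \<open>t0 \<in> {a..b}\<close> c(1) open_chronological_future[OF M], of y] by metis
    have "?P s t" if "s \<le> t0 \<and> t0 \<le> t \<and> t - s < \<delta>" for s t
      using \<delta>(2)[of s t] that by (cases "s = t") (auto simp: J_def)
    with \<delta>(1) show "\<exists>\<delta>>0. \<forall>s t. s \<le> t0 \<and> t0 \<le> t \<and> t - s < \<delta> \<longrightarrow> ?P s t"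
      by blast
  qed
  with \<open>a \<le> b\<close> y show ?thesis
    by (simp add: J_def)
qed

lemma push_up:
  assumes M: "smooth_spacetime M" and "chronological M p q" "causal M q r"
  shows "chronological M p r"
proof (cases "q = r")
  case False
  then obtain \<gamma> a b n s where *: "\<gamma> a = q" "\<gamma> b = r" "s 0 = a" "s n = b"
    "\<forall>i<n. s i < s (Suc i) \<and> segment_with (future_causal M) M \<gamma> (s i) (s (Suc i))"
    using assms(3) unfolding causal_def causal_curve_eq piecewise_def by blast
  have "chronological M p (\<gamma> (s i))" if "i \<le> n" for i
    using that
  proof (induction i)
    case (Suc i)
    then show ?case
      using push_up_segment[OF M, of \<gamma> "s i" "s (Suc i)" p] *(5) by simp
  qed (use * assms(2) in simp)
  then show ?thesis
    using * by blast
qed (use assms(2) in simp)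

section \<open>Suprema and maps with the monotone convergence property\<close>

lemma is_lub_iff:
  assumes "A \<subseteq> carrier X"
  shows "is_lub X s A \<longleftrightarrow> s \<in> carrier X \<and> (\<forall>x\<in>A. x \<sqsubseteq>\<^bsub>X\<^esub> s) \<and>
    (\<forall>u\<in>carrier X. (\<forall>x\<in>A. x \<sqsubseteq>\<^bsub>X\<^esub> u) \<longrightarrow> s \<sqsubseteq>\<^bsub>X\<^esub> u)"
  using assms unfolding least_def Upper_def by blast

lemma is_lub_unique:
  assumes "partial_order X" "is_lub X s A" "is_lub X t A"
  shows "s = t"
proof -
  interpret partial_order X by fact
  show ?thesis using assms(2,3) least_unique by (simp add: eq_is_equal)
qed

lemma directed_subset_pair:
  assumes "partial_order X" "x \<in> carrier X" "y \<in> carrier X" "x \<sqsubseteq>\<^bsub>X\<^esub> y"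
  shows "directed_subset X {x, y}" "is_lub X y {x, y}"
proof -
  interpret partial_order X by fact
  show "directed_subset X {x, y}" "is_lub X y {x, y}"
    using assms(2-4) by (auto simp: directed_subset_def is_lub_iff)
qed

text \<open>
  If \<open>x\<close> lies below \<open>y\<close> then \<open>{x, y}\<close> is directed with supremum \<open>y\<close>, so the monotone convergence property
  contains monotonicity.
\<close>

lemma Mcp_mono:
  assumes "partial_order X" "Mcp X Y T" "x \<in> carrier X" "y \<in> carrier X" "x \<sqsubseteq>\<^bsub>X\<^esub> y"
  shows "T x \<sqsubseteq>\<^bsub>Y\<^esub> T y"
proof -
  have lub: "is_lub Y (T y) (T ` {x, y})"
    using directed_subset_pair[OF assms(1,3-5)] assms(2) unfolding Mcp_def by blast
  have sub: "T ` {x, y} \<subseteq> carrier Y"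
    using assms(2-4) by (auto simp: Mcp_def)
  show ?thesis
    using lub unfolding is_lub_iff[OF sub] by simp
qed

lemma directed_subset_image:
  assumes "partial_order X" "Mcp X Y T" "directed_subset X D"
  shows "directed_subset Y (T ` D)"
  unfolding directed_subset_def
proof (intro conjI allI impI)
  have D: "D \<subseteq> carrier X"
    using assms(3) by (simp add: directed_subset_def)
  then show "T ` D \<subseteq> carrier Y"
    using assms(2) by (auto simp: Mcp_def)
  fix F assume "finite F \<and> F \<subseteq> T ` D"
  then obtain F' where F': "F' \<subseteq> D" "finite F'" "F = T ` F'"
    by (meson finite_subset_image)
  then obtain u where "u \<in> D" "\<forall>x\<in>F'. x \<sqsubseteq>\<^bsub>X\<^esub> u"
    using assms(3) unfolding directed_subset_def by blast
  then show "\<exists>u\<in>T ` D. \<forall>x\<in>F. x \<sqsubseteq>\<^bsub>Y\<^esub> u"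
    using F' D Mcp_mono[OF assms(1,2)] by blast
qed

text \<open>
  A criterion for directed completions. \<open>B P\<close> is a canonical directed set of elements of \<open>X\<close> approximating
  \<open>P\<close>. The extension of \<open>T\<close> is \<open>P \<mapsto> sup T(B P)\<close>: uniqueness is the second assumption on \<open>B\<close>, the extension
  property is the third, and compatibility of \<open>B\<close> with directed suprema gives its monotone convergence.
\<close>

lemma directed_completionI:
  fixes X :: "'a gorder" and Y :: "'b gorder"
  assumes X: "partial_order X" and Y: "directed_complete Y" and \<iota>: "Mcp X Y \<iota>"
    and B: "\<And>P. P \<in> carrier Y \<Longrightarrow> directed_subset X (B P)"
    and lub_B: "\<And>P. P \<in> carrier Y \<Longrightarrow> is_lub Y P (\<iota> ` B P)"
    and lub_\<iota>: "\<And>x. x \<in> carrier X \<Longrightarrow> is_lub X x (B (\<iota> x))"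
    and UN_B: "\<And>\<D> P. directed_subset Y \<D> \<Longrightarrow> is_lub Y P \<D> \<Longrightarrow> B P = (\<Union>Q\<in>\<D>. B Q)"
  shows "directed_completion TYPE('z) X Y \<iota>"
  unfolding directed_completion_def
proof (intro conjI allI impI X Y \<iota>)
  fix Z :: "'z gorder" and T
  assume "directed_complete Z \<and> Mcp X Z T"
  then have Z: "directed_complete Z" "partial_order Z" and T: "Mcp X Z T"
    by (auto simp: directed_complete_def)
  interpret Z: partial_order Z by fact
  have \<iota>_in: "\<iota> x \<in> carrier Y" if "x \<in> carrier X" for x
    using \<iota> that by (auto simp: Mcp_def)
  have TB: "directed_subset Z (T ` B P)" "T ` B P \<subseteq> carrier Z" if "P \<in> carrier Y" for P
    using directed_subset_image[OF X T B[OF that]] by (auto simp: directed_subset_def)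
  define T' where "T' = restrict (\<lambda>P. SOME s. is_lub Z s (T ` B P)) (carrier Y)"
  have lub: "is_lub Z (T' P) (T ` B P)" if "P \<in> carrier Y" for P
    using Z(1) TB(1)[OF that] that unfolding T'_def directed_complete_def
    by (simp add: someI_ex[of "\<lambda>s. is_lub Z s (T ` B P)"])
  have lub': "T' P \<in> carrier Z \<and> (\<forall>x\<in>B P. T x \<sqsubseteq>\<^bsub>Z\<^esub> T' P) \<and>
      (\<forall>u\<in>carrier Z. (\<forall>x\<in>B P. T x \<sqsubseteq>\<^bsub>Z\<^esub> u) \<longrightarrow> T' P \<sqsubseteq>\<^bsub>Z\<^esub> u)" if "P \<in> carrier Y" for P
    using lub[OF that] is_lub_iff[OF TB(2)[OF that]] by simp
  have T'_in: "T' \<in> carrier Y \<rightarrow> carrier Z"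
    using lub' by auto
  have "Mcp Y Z T'"
    unfolding Mcp_def
  proof (intro conjI allI impI T'_in, elim conjE)
    fix \<D> P assume \<D>: "directed_subset Y \<D>" "is_lub Y P \<D>"
    then have in_Y: "\<D> \<subseteq> carrier Y" "P \<in> carrier Y"
      using is_lub_iff by (auto simp: directed_subset_def)
    have BP: "B P = (\<Union>Q\<in>\<D>. B Q)"
      using UN_B[OF \<D>] .
    have "T' Q \<sqsubseteq>\<^bsub>Z\<^esub> T' P" if "Q \<in> \<D>" for Q
    proof -
      have "Q \<in> carrier Y" "B Q \<subseteq> B P"
        using that in_Y BP by auto
      moreover from this have "\<forall>x\<in>B Q. T x \<sqsubseteq>\<^bsub>Z\<^esub> T' P"
        using lub'[OF in_Y(2)] by auto
      ultimately show ?thesis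
        using lub'[of Q] lub'[OF in_Y(2)] by simp
    qed
    moreover have "T' P \<sqsubseteq>\<^bsub>Z\<^esub> u" if u: "u \<in> carrier Z" "\<forall>Q\<in>\<D>. T' Q \<sqsubseteq>\<^bsub>Z\<^esub> u" for u
    proof -
      have "T x \<sqsubseteq>\<^bsub>Z\<^esub> u" if "x \<in> B P" for x
      proof -
        obtain Q where Q: "Q \<in> \<D>" "x \<in> B Q"
          using \<open>x \<in> B P\<close> BP by blast
        then have "Q \<in> carrier Y" using in_Y by blast
        then have "T x \<in> carrier Z" "T' Q \<in> carrier Z" "T x \<sqsubseteq>\<^bsub>Z\<^esub> T' Q"
          using lub'[of Q] TB(2)[of Q] Q(2) by auto
        then show ?thesis
          using Z.le_trans[of "T x" "T' Q" u] u Q(1) by simp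
      qed
      then show ?thesis
        using lub'[OF in_Y(2)] u(1) by simp
    qed
    ultimately show "is_lub Z (T' P) (T' ` \<D>)"
      using T'_in in_Y by (subst is_lub_iff) auto
  qed
  moreover have "T' (\<iota> x) = T x" if "x \<in> carrier X" for x
  proof (rule is_lub_unique[OF Z(2) lub[OF \<iota>_in[OF that]]])
    show "is_lub Z (T x) (T ` B (\<iota> x))"
      using T B[OF \<iota>_in[OF that]] lub_\<iota>[OF that] by (auto simp: Mcp_def)
  qed
  moreover have "T'' = T'"
    if T'': "T'' \<in> extensional (carrier Y)" "Mcp Y Z T''" "\<forall>x\<in>carrier X. T'' (\<iota> x) = T x" for T''
  proof (rule extensionalityI[OF T''(1)])
    show "T' \<in> extensional (carrier Y)" by (simp add: T'_def)
    fix P assume P: "P \<in> carrier Y"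
    have "T'' ` \<iota> ` B P = T ` B P"
      using T''(3) B[OF P] unfolding directed_subset_def image_image by (intro image_cong) auto
    moreover have "is_lub Z (T'' P) (T'' ` \<iota> ` B P)"
      using T''(2) lub_B[OF P] directed_subset_image[OF X \<iota> B[OF P]] by (auto simp: Mcp_def)
    ultimately show "T'' P = T' P"
      using is_lub_unique[OF Z(2) _ lub[OF P]] by simp
  qed
  ultimately show "\<exists>!T'. T' \<in> extensional (carrier Y) \<and> Mcp Y Z T' \<and>
      (\<forall>x\<in>carrier X. T' (\<iota> x) = T x)"
    by (intro ex1I[of _ T']) (auto simp: T'_def)
qed

section \<open>The completion by indecomposable past sets\<close>

locale chronological_causal_order =
  fixes M :: "('m::t2_space, 'e::euclidean_space) spacetime"
  assumes chron_trans: "chronological M p q \<Longrightarrow> chronological M q r \<Longrightarrow> chronological M p r"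
    and caus_refl: "causal M p p"
    and caus_trans: "causal M p q \<Longrightarrow> causal M q r \<Longrightarrow> causal M p r"
    and caus_antisym: "causal M p q \<Longrightarrow> causal M q p \<Longrightarrow> p = q"
    and chron_imp_caus: "chronological M p q \<Longrightarrow> causal M p q"
    and push_up: "chronological M p q \<Longrightarrow> causal M q r \<Longrightarrow> chronological M p r"
    and open_future: "open {q. chronological M p q}"
    and past_dense: "open U \<Longrightarrow> q \<in> U \<Longrightarrow> \<exists>p\<in>U. chronological M p q"
    and compact_diamond: "compact {r. causal M p r \<and> causal M r q}"
begin

lemma past_set_iff: "past_set M U \<longleftrightarrow> (\<forall>y. y \<in> U \<longleftrightarrow> (\<exists>x\<in>U. chronological M y x))"
  unfolding past_set_def chron_past_def by blast

text \<open>
  The common future of \<open>x\<close> and \<open>y\<close> is an open neighbourhood of \<open>q\<close>, so it contains points of the past of \<open>q\<close>.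
\<close>

lemma common_interpolation:
  assumes "chronological M x q" "chronological M y q"
  shows "\<exists>z. chronological M x z \<and> chronological M y z \<and> chronological M z q"
  using past_dense[of "{z. chronological M x z} \<inter> {z. chronological M y z}" q] assms open_future
  by auto

lemma past_set_past: "past_set M (\<Union>x\<in>A. chron_past M x)"
  unfolding past_set_iff
proof (intro allI iffI)
  fix y assume "y \<in> (\<Union>x\<in>A. chron_past M x)"
  then obtain x where "x \<in> A" "chronological M y x"
    by (auto simp: chron_past_def)
  moreover from this obtain z where "chronological M y z" "chronological M z x"
    using common_interpolation[of y x y] by blast
  ultimately show "\<exists>z\<in>\<Union>x\<in>A. chron_past M x. chronological M y z"
    by (auto simp: chron_past_def)
next
  fix y assume "\<exists>z\<in>\<Union>x\<in>A. chron_past M x. chronological M y z"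
  then show "y \<in> (\<Union>x\<in>A. chron_past M x)"
    using chron_trans by (auto simp: chron_past_def)
qed

text \<open>
  If \<open>P\<close> is indecomposable and \<open>x \<in> P\<close>, split \<open>P\<close> into the pasts of its points inside and outside the future
  of \<open>x\<close>. The second part omits \<open>x\<close>, so \<open>P\<close> is the first part; every \<open>y \<in> P\<close> thus precedes some point of \<open>P\<close> in
  the future of \<open>x\<close>. Conversely, from \<open>x\<close> outside \<open>U\<^sub>1\<close> and \<open>y\<close> outside \<open>U\<^sub>2\<close>, a common successor in \<open>P\<close> lies in
  neither part, as past sets contain all predecessors of their points.
\<close>

lemma indecomposable_past_set_iff:
  "indecomposable_past_set M P \<longleftrightarrow> P \<noteq> {} \<and> past_set M P \<and>
     (\<forall>x\<in>P. \<forall>y\<in>P. \<exists>z\<in>P. chronological M x z \<and> chronological M y z)"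
proof (intro iffI conjI ballI; (elim conjE)?)
  assume P: "indecomposable_past_set M P"
  then show "P \<noteq> {}" and past: "past_set M P"
    by (auto simp: indecomposable_past_set_def)
  fix x y assume xy: "x \<in> P" "y \<in> P"
  define F where "F = {z \<in> P. chronological M x z}"
  let ?U1 = "\<Union>z\<in>F. chron_past M z" and ?U2 = "\<Union>z\<in>P - F. chron_past M z"
  have P_eq: "P = (\<Union>z\<in>P. chron_past M z)"
    using past by (simp add: past_set_def)
  have un: "?U1 \<union> ?U2 = P"
  proof -
    have "?U1 \<union> ?U2 = (\<Union>z\<in>P. chron_past M z)"
      by (auto simp: F_def)
    then show ?thesis
      using P_eq by simp
  qed
  then have "?U1 \<subseteq> P" "?U2 \<subseteq> P"
    by blast+
  with P past_set_past un have "P = ?U1 \<or> P = ?U2"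
    unfolding indecomposable_past_set_def by metis
  moreover have "x \<notin> ?U2"
    by (auto simp: F_def chron_past_def)
  ultimately have "y \<in> ?U1"
    using xy by blast
  then show "\<exists>z\<in>P. chronological M x z \<and> chronological M y z"
    by (auto simp: F_def chron_past_def)
next
  assume P: "P \<noteq> {}" "past_set M P"
    "\<forall>x\<in>P. \<forall>y\<in>P. \<exists>z\<in>P. chronological M x z \<and> chronological M y z"
  have "P = U1 \<or> P = U2"
    if U: "past_set M U1" "past_set M U2" "P = U1 \<union> U2" for U1 U2
  proof (rule ccontr)
    assume "\<not> (P = U1 \<or> P = U2)"
    then obtain x y where "x \<in> P" "x \<notin> U1" "y \<in> P" "y \<notin> U2"
      using U(3) by blast
    moreover from this obtain z where "z \<in> U1 \<union> U2" "chronological M x z" "chronological M y z"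
      using P(3) U(3) by blast
    ultimately show False
      using U(1,2) unfolding past_set_iff by blast
  qed
  then show "indecomposable_past_set M P"
    using P unfolding indecomposable_past_set_def by blast
qed

lemma indecomposable_chron_past: "indecomposable_past_set M (chron_past M x)"
proof -
  have "chron_past M x \<noteq> {}"
    using past_dense[of UNIV x] by (auto simp: chron_past_def)
  moreover have "past_set M (chron_past M x)"
    using past_set_past[of "{x}"] by simp
  moreover have "\<exists>z\<in>chron_past M x. chronological M y z \<and> chronological M y' z"
    if y: "y \<in> chron_past M x" "y' \<in> chron_past M x" for y y'
  proof -
    obtain z where "chronological M y z" "chronological M y' z" "chronological M z x"
      using common_interpolation[of y x y'] y by (auto simp: chron_past_def)
    then show ?thesis
      by (auto simp: chron_past_def)
  qed
  ultimately show ?thesis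
    by (simp add: indecomposable_past_set_iff)
qed

lemma chron_past_mono: "causal M x y \<Longrightarrow> chron_past M x \<subseteq> chron_past M y"
  unfolding chron_past_def using push_up by blast

abbreviation "X \<equiv> causal_poset M"
abbreviation "Y \<equiv> future_causal_completion M"

lemma carrier_completion: "P \<in> carrier Y \<longleftrightarrow> indecomposable_past_set M P"
  by (simp add: future_causal_completion_def)

lemma partial_order_causal: "partial_order X"
proof unfold_locales
  show "x \<sqsubseteq>\<^bsub>X\<^esub> z" if "x \<sqsubseteq>\<^bsub>X\<^esub> y" "y \<sqsubseteq>\<^bsub>X\<^esub> z" for x y z
    using that caus_trans[of x y z] by (simp add: causal_poset_def)
  show "x .=\<^bsub>X\<^esub> y" if "x \<sqsubseteq>\<^bsub>X\<^esub> y" "y \<sqsubseteq>\<^bsub>X\<^esub> x" for x y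
    using that caus_antisym[of x y] by (simp add: causal_poset_def)
qed (simp_all add: causal_poset_def caus_refl)

lemma partial_order_completion: "partial_order Y"
  by unfold_locales (auto simp: future_causal_completion_def)

lemma is_lub_causal_iff: "is_lub X s D \<longleftrightarrow>
    (\<forall>x\<in>D. causal M x s) \<and> (\<forall>u. (\<forall>x\<in>D. causal M x u) \<longrightarrow> causal M s u)"
  by (subst is_lub_iff) (auto simp: causal_poset_def)

lemma is_lub_completionI:
  assumes "\<D> \<subseteq> carrier Y" "P \<in> carrier Y" "P = \<Union>\<D>"
  shows "is_lub Y P \<D>"
  using assms by (subst is_lub_iff) (auto simp: future_causal_completion_def)

lemma indecomposable_Union:
  assumes "directed_subset Y \<D>"
  shows "\<Union>\<D> \<in> carrier Y"
proof -
  have sub: "\<And>P. P \<in> \<D> \<Longrightarrow> indecomposable_past_set M P"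
    and dir: "\<And>F. finite F \<Longrightarrow> F \<subseteq> \<D> \<Longrightarrow> \<exists>Q\<in>\<D>. \<forall>P\<in>F. P \<subseteq> Q"
    using assms by (auto simp: directed_subset_def future_causal_completion_def)
  have ne: "P \<noteq> {}" and past: "(\<Union>x\<in>P. chron_past M x) = P"
    and up: "\<And>x y. x \<in> P \<Longrightarrow> y \<in> P \<Longrightarrow> \<exists>z\<in>P. chronological M x z \<and> chronological M y z"
    if "P \<in> \<D>" for P
    using sub[OF that] by (simp_all add: indecomposable_past_set_iff past_set_def)
  have "\<Union>\<D> \<noteq> {}"
    using dir[of "{}"] ne by auto
  moreover have "past_set M (\<Union>\<D>)"
    unfolding past_set_def UN_UN_flatten using past by simp
  moreover have "\<exists>z\<in>\<Union>\<D>. chronological M x z \<and> chronological M y z"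
    if xy: "x \<in> \<Union>\<D>" "y \<in> \<Union>\<D>" for x y
  proof -
    obtain P P' where "P \<in> \<D>" "x \<in> P" "P' \<in> \<D>" "y \<in> P'"
      using xy by blast
    moreover from this obtain Q where "Q \<in> \<D>" "P \<subseteq> Q" "P' \<subseteq> Q"
      using dir[of "{P, P'}"] by auto
    ultimately show ?thesis
      using up[of Q x y] by blast
  qed
  ultimately show ?thesis
    by (simp only: carrier_completion indecomposable_past_set_iff) simp
qed

lemma is_lub_completion_iff:
  assumes "directed_subset Y \<D>"
  shows "is_lub Y P \<D> \<longleftrightarrow> P = \<Union>\<D>"
proof
  have lub: "is_lub Y (\<Union>\<D>) \<D>"
    using assms indecomposable_Union is_lub_completionI by (auto simp: directed_subset_def)
  then show "P = \<Union>\<D>" if "is_lub Y P \<D>"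
    using is_lub_unique[OF partial_order_completion that] by blast
  show "is_lub Y P \<D>" if "P = \<Union>\<D>"
    using lub that by simp
qed

lemma directed_complete_completion: "directed_complete Y"
  unfolding directed_complete_def using partial_order_completion is_lub_completion_iff by blast

text \<open>
  By directedness the closed tails of \<open>D\<close> have the finite intersection property in the compact diamond between
  some \<open>d\<^sub>0 \<in> D\<close> and \<open>s\<close>. A common point \<open>r\<close> of all tails satisfies \<open>d \<le> r \<le> s\<close> for each \<open>d \<in> D\<close>, as diamonds are closed;
  since \<open>s\<close> is the least upper bound, \<open>r = s\<close>.
\<close>

lemma lub_in_closure:
  assumes D: "directed_subset X D" and s: "is_lub X s D"
  shows "s \<in> closure D"
proof -
  have dir: "\<exists>u\<in>D. \<forall>x\<in>F. causal M x u" if "finite F" "F \<subseteq> D" for F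
    using D that by (auto simp: directed_subset_def causal_poset_def)
  obtain d0 where d0: "d0 \<in> D"
    using dir[of "{}"] by auto
  have ub: "causal M d s" if "d \<in> D" for d
    using s that by (simp add: is_lub_causal_iff)
  define K where "K = {r. causal M d0 r \<and> causal M r s}"
  define tail where "tail d = closure {e \<in> D. causal M d e}" for d
  have tail: "tail d \<subseteq> {r. causal M d r \<and> causal M r s}" for d
    unfolding tail_def
    by (rule closure_minimal) (use ub compact_diamond compact_imp_closed in auto)
  have "K \<inter> \<Inter> (tail ` D) \<noteq> {}"
  proof (rule compact_imp_fip)
    fix \<F> assume "finite \<F>" "\<F> \<subseteq> tail ` D"
    then obtain F where F: "F \<subseteq> D" "finite F" "\<F> = tail ` F"
      by (meson finite_subset_image)
    then obtain u where "u \<in> D" "\<forall>x\<in>insert d0 F. causal M x u"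
      using dir[of "insert d0 F"] d0 by auto
    then have "u \<in> K \<inter> \<Inter>\<F>"
      using F(3) ub closure_subset by (fastforce simp: K_def tail_def)
    then show "K \<inter> \<Inter>\<F> \<noteq> {}"
      by blast
  qed (auto simp: K_def compact_diamond tail_def)
  then obtain r where r: "\<And>d. d \<in> D \<Longrightarrow> r \<in> tail d"
    by blast
  then have "causal M d r \<and> causal M r s" if "d \<in> D" for d
    using tail[of d] that by auto
  then have "r = s"
    using s caus_antisym[of r s] d0 by (auto simp: is_lub_causal_iff)
  then show ?thesis
    using r[OF d0] closure_mono[of "{e \<in> D. causal M d0 e}" D] unfolding tail_def by blast
qed

text \<open>
  Every past of a point of \<open>D\<close> lies in the past of the supremum \<open>s\<close> by push-up. Conversely, if \<open>y \<ll> s\<close>, the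
  open future of \<open>y\<close> contains \<open>s\<close>, a point of the closure of \<open>D\<close>, and so meets \<open>D\<close>.
\<close>

lemma Mcp_chron_past: "Mcp X Y (chron_past M)"
  unfolding Mcp_def
proof (intro conjI allI impI; (elim conjE)?)
  show "chron_past M \<in> carrier X \<rightarrow> carrier Y"
    using indecomposable_chron_past by (simp add: carrier_completion)
  fix D s assume D: "directed_subset X D" and s: "is_lub X s D"
  have "chron_past M s \<subseteq> (\<Union>d\<in>D. chron_past M d)"
  proof
    fix y assume "y \<in> chron_past M s"
    then have "s \<in> {q. chronological M y q}"
      by (simp add: chron_past_def)
    with lub_in_closure[OF D s] open_future[of y] show "y \<in> (\<Union>d\<in>D. chron_past M d)"
      unfolding closure_iff_nhds_not_empty chron_past_def by blast
  qed
  moreover have "chron_past M d \<subseteq> chron_past M s" if "d \<in> D" for d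
    using s that chron_past_mono by (simp add: is_lub_causal_iff)
  ultimately show "is_lub Y (chron_past M s) (chron_past M ` D)"
    using indecomposable_chron_past by (intro is_lub_completionI) (auto simp: carrier_completion)
qed

lemma directed_indecomposable:
  assumes "P \<in> carrier Y"
  shows "directed_subset X P"
proof -
  have P: "P \<noteq> {}" "\<forall>x\<in>P. \<forall>y\<in>P. \<exists>z\<in>P. chronological M x z \<and> chronological M y z"
    using assms unfolding carrier_completion indecomposable_past_set_iff by auto
  have "\<exists>u\<in>P. \<forall>x\<in>F. causal M x u" if "finite F" "F \<subseteq> P" for F
    using that
  proof (induction F)
    case (insert x F)
    then obtain u where "u \<in> P" "\<forall>x\<in>F. causal M x u"
      by auto
    moreover from this obtain z where z: "z \<in> P" "chronological M u z" "chronological M x z"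
      using P(2) insert.prems by blast
    ultimately have "\<forall>y\<in>insert x F. causal M y z"
      using chron_imp_caus caus_trans[OF _ chron_imp_caus[of u z]] by simp
    then show ?case
      using z(1) by blast
  qed (use P(1) in blast)
  then show ?thesis
    by (auto simp: directed_subset_def causal_poset_def)
qed

text \<open>
  Let \<open>z\<close> be an upper bound of the past of \<open>x\<close>, and \<open>y \<ll> x\<close>. Points of the past of \<open>x\<close> close to \<open>x\<close> lie in the
  diamond between \<open>y\<close> and \<open>z\<close>, which is closed and therefore contains \<open>x\<close>.
\<close>

lemma is_lub_chron_past: "is_lub X x (chron_past M x)"
  unfolding is_lub_causal_iff
proof (intro conjI allI impI ballI)
  fix y assume "y \<in> chron_past M x"
  then show "causal M y x"
    by (simp add: chron_past_def chron_imp_caus)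
next
  fix z assume z: "\<forall>y\<in>chron_past M x. causal M y z"
  obtain y where y: "chronological M y x"
    using past_dense[of UNIV x] by auto
  let ?J = "{r. causal M y r \<and> causal M r z}"
  have "x \<in> closure ?J"
    unfolding closure_iff_nhds_not_empty
  proof (intro allI impI)
    fix A V assume V: "V \<subseteq> A" "open V" "x \<in> V"
    then obtain r where "r \<in> V" "chronological M y r" "chronological M r x"
      using past_dense[of "V \<inter> {q. chronological M y q}" x] y open_future by auto
    then have "r \<in> ?J \<inter> A"
      using V(1) z chron_imp_caus by (auto simp: chron_past_def)
    then show "?J \<inter> A \<noteq> {}"
      by blast
  qed
  then show "causal M x z"
    using compact_imp_closed[OF compact_diamond] by (simp add: closure_closed)
qed

text \<open>
  An indecomposable past set is itself the directed set of points approximating it.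
\<close>

lemma directed_completion_indecomposable:
  "directed_completion TYPE('z) X Y (chron_past M)"
proof (rule directed_completionI[where B = "\<lambda>P. P"])
  fix P assume P: "P \<in> carrier Y"
  then have "P = \<Union> (chron_past M ` P)"
    by (simp add: carrier_completion indecomposable_past_set_def past_set_def)
  then show "is_lub Y P (chron_past M ` P)"
    using P indecomposable_chron_past by (intro is_lub_completionI) (auto simp: carrier_completion)
qed (auto simp: partial_order_causal directed_complete_completion Mcp_chron_past directed_indecomposable
    is_lub_chron_past is_lub_completion_iff)

end

section \<open>Globally hyperbolic spacetimes\<close>

lemma globally_hyperbolic_order:
  assumes M: "smooth_spacetime M" and "globally_hyperbolic M"
  shows "chronological_causal_order M"
proof
  have sc: "strongly_causal M"
    using assms(2) by (simp add: globally_hyperbolic_def)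
  show "causal M p q" if "chronological M p q" for p q
  proof (rule chronological_imp_causal[OF that])
    show "bilinear (metric M c x)" if "c \<in> atlas M" "x \<in> chart_dom c" for c x
      using M that unfolding smooth_spacetime_def lorentzian_metric_def lorentzian_form_def by blast
  qed
  show "p = q" if "causal M p q" "causal M q p" for p q
    using strongly_causal_imp_antisym[OF sc that] .
  show "compact {r. causal M p r \<and> causal M r q}" for p q
    using assms(2) by (simp add: globally_hyperbolic_def)
qed (fact chronological_trans causal_refl causal_trans push_up[OF M]
    open_chronological_future[OF M] past_accumulates[OF M])+

theorem proposition3p17:
  fixes M :: "('m::{t2_space,second_countable_topology}, 'e::euclidean_space) spacetime"
  assumes "smooth_spacetime M"
    and "globally_hyperbolic M"
  shows "directed_completion TYPE('z) (causal_poset M) (future_causal_completion M) (chron_past M)"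
proof -
  interpret chronological_causal_order M
    using globally_hyperbolic_order[OF assms] .
  show ?thesis
    by (rule directed_completion_indecomposable)
qed

end
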